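(* Let $(A,\mathcal{C})$ be a crossed monoid over a small category $\mathcal{C}$ such that (i) for every object $t$ of $\mathcal{C}$ the monoid $A(t)$ has the left and right cancellation properties; and (ii) for every morphism $\gamma\in\mathcal{C}(s,t)$ of $\mathcal{C}$ the map $A(t)\to A(s)$, $a\mapsto a^\gamma$, is injective. Then the simplicial set $N(A,\mathcal{C})$ is $3$-coskeletal.
   Context: Coskeletality. For a simplicial set $X$, let $\mathrm{tr}^n$ be the truncation functor from simplicial sets to $n$-truncated simplicial sets, $\mathrm{cosk}^n$ its right adjoint, and $\mathbf{Cosk}^n=\mathrm{cosk}^n\mathrm{tr}^n$. $X$ is $n$-coskeletal if the unit map $X\to\mathbf{Cosk}^nX$ is an isomorphism. Crossed monoids. $\mathcal{C}$ is a small category with object set $\mathcal{C}_0$ and morphism set $\mathcal{C}_1$; $\mathcal{C}(s,t)$ is the set of morphisms with source $s$ and target $t$, and $\alpha\beta$ means $\alpha$ after $\beta$. A crossed monoid $(A,\mathcal{C})$ over $\mathcal{C}$ is a contravariant functor $A$ from $\mathcal{C}$ to the category of monoids (for $\alpha\in\mathcal{C}(s,t)$ and $a\in A(t)$ write $a^\alpha:=A(\alpha)(a)\in A(s)$) together with monoid homomorphisms $\partial_t\colon A(t)\to\mathcal{C}(t,t)$, $t\in\mathcal{C}_0$, such that $\alpha\,\partial_s(a^\alpha)=\partial_t(a)\,\alpha$ and $ab=b\,a^{\partial_t b}$ for all $s,t\in\mathcal{C}_0$, $\alpha\in\mathcal{C}(s,t)$, $a,b\in A(t)$. The unit of $A(x)$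 is $e_x$, the identity of $x$ is $1_x$; write $\partial$ for $\partial_t$. Nerve. The simplicial set $N(A,\mathcal{C})$ is as follows. $N_0(A,\mathcal{C})=\mathcal{C}_0$. For $n\ge1$, $N_n(A,\mathcal{C})$ is the set of $n\times n$ upper triangular matrices $M=(m_{ij})_{1\le i\le j\le n}$ (entries below the diagonal are absent) for which there is a sequence $(x_0,\dots,x_n)$ of objects of $\mathcal{C}$ with $m_{jj}\in\mathcal{C}(x_j,x_{j-1})$ for $1\le j\le n$ and $m_{ij}\in A(x_i)$ for $1\le i<j\le n$. Thus $N_1(A,\mathcal{C})=\mathcal{C}_1$. Degeneracies: $s_0\colon N_0\to N_1$ is $p\mapsto 1_p$. For $n\ge1$, $M\in N_n$, $0\le j\le n$, $s_j(M)=M'\in N_{n+1}$ with: for $i\le j$: $m'_{ik}=m_{ik}$ if $k\le j$, $m'_{i,j+1}=e_{x_i}$, $m'_{ik}=m_{i,k-1}$ if $k>j+1$; $m'_{j+1,j+1}=1_{x_j}$ and $m'_{j+1,k}=e_{x_j}$ for $k>j+1$; for $i>j+1$: $m'_{ik}=m_{i-1,k-1}$. Faces: on $N_1$, $d_0$ is the source map and $d_1$ the target map. For $n\ge2$, $M\in N_n$, $d_j(M)=M'\in N_{n-1}$ with: for $j=0$: $m'_{ik}=m_{i+1,k+1}$; for $j=n$: $m'_{ik}=m_{ik}$; for $1\le j\le n-1$: if $i<j$ then $m'_{ik}=m_{ik}$ for $k<j$, $m'_{ij}=m_{ij}m_{i,j+1}$, $m'_{ik}=m_{i,k+1}$ for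 $k>j$; $m'_{jj}=m_{jj}\,\partial(m_{j,j+1})\,m_{j+1,j+1}$; $m'_{jk}=(m_{j,k+1})^{\eta_k}\,m_{j+1,k+1}$ for $k>j$, where $\eta_k=m_{j+1,j+1}\,\partial(m_{j+1,j+2}\cdots m_{j+1,k})$ (empty product being the unit, so $\eta_{j+1}=m_{j+1,j+1}$); and $m'_{ik}=m_{i+1,k+1}$ for $i>j$. *)

theory Defs
  imports "HOL-Library.FuncSet" "HOL-Library.Extended_Nat" "HOL-Algebra.Group"
begin

section \<open>Simplicial sets and truncated simplicial sets\<close>

text \<open>
  A simplicial set is given by its sets of simplices together with its face and degeneracy maps:
  \<open>face X n j\<close> is \<open>d\<^sub>j : X\<^sub>n \<rightarrow> X\<^sub>n\<^sub>-\<^sub>1\<close> (for \<open>n \<ge> 1\<close>) and \<open>degen X n j\<close> is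
  \<open>s\<^sub>j : X\<^sub>n \<rightarrow> X\<^sub>n\<^sub>+\<^sub>1\<close>, with \<open>0 \<le> j \<le> n\<close> in both cases. The degree is an argument
  because simplices of different degrees share one type and their sets need not be disjoint.
\<close>

record 'a sset =
  simplices :: "nat \<Rightarrow> 'a set"
  face :: "nat \<Rightarrow> nat \<Rightarrow> 'a \<Rightarrow> 'a"
  degen :: "nat \<Rightarrow> nat \<Rightarrow> 'a \<Rightarrow> 'a"

text \<open>
  For \<open>N = n\<close> finite this is an \<open>n\<close>-truncated simplicial set (whatever the record contains in
  degrees above \<open>n\<close> is ignored); for \<open>N = \<infinity>\<close> it is a simplicial set.
\<close>

locale simplicial_set_upto =
  fixes N :: enat and X :: "'a sset"
  assumes face_in:
      "\<lbrakk>enat (Suc n) \<le> N; j \<le> Suc n; x \<in> simplices X (Suc n)\<rbrakk>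
        \<Longrightarrow> face X (Suc n) j x \<in> simplices X n"
    and degen_in:
      "\<lbrakk>enat (Suc n) \<le> N; j \<le> n; x \<in> simplices X n\<rbrakk>
        \<Longrightarrow> degen X n j x \<in> simplices X (Suc n)"
    and face_face:
      "\<lbrakk>enat (Suc (Suc n)) \<le> N; i < j; j \<le> Suc (Suc n); x \<in> simplices X (Suc (Suc n))\<rbrakk>
        \<Longrightarrow> face X (Suc n) i (face X (Suc (Suc n)) j x)
          = face X (Suc n) (j - 1) (face X (Suc (Suc n)) i x)"
    and degen_degen:
      "\<lbrakk>enat (Suc (Suc n)) \<le> N; i \<le> j; j \<le> n; x \<in> simplices X n\<rbrakk>
        \<Longrightarrow> degen X (Suc n) i (degen X n j x) = degen X (Suc n) (Suc j) (degen X n i x)"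
    and face_degen_below:
      "\<lbrakk>enat (Suc (Suc n)) \<le> N; i < j; j \<le> Suc n; x \<in> simplices X (Suc n)\<rbrakk>
        \<Longrightarrow> face X (Suc (Suc n)) i (degen X (Suc n) j x) = degen X n (j - 1) (face X (Suc n) i x)"
    and face_degen_id:
      "\<lbrakk>enat (Suc n) \<le> N; j \<le> n; i = j \<or> i = Suc j; x \<in> simplices X n\<rbrakk>
        \<Longrightarrow> face X (Suc n) i (degen X n j x) = x"
    and face_degen_above:
      "\<lbrakk>enat (Suc (Suc n)) \<le> N; Suc j < i; i \<le> Suc (Suc n); x \<in> simplices X (Suc n)\<rbrakk>
        \<Longrightarrow> face X (Suc (Suc n)) i (degen X (Suc n) j x) = degen X n j (face X (Suc n) (i - 1) x)"

abbreviation simplicial_set :: "'a sset \<Rightarrow> bool"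
  where "simplicial_set \<equiv> simplicial_set_upto \<infinity>"

text \<open>
  Morphisms are extensional, so that equality of morphisms is equality of HOL functions.
\<close>

definition simplicial_map_upto ::
    "enat \<Rightarrow> 'a sset \<Rightarrow> 'b sset \<Rightarrow> (nat \<Rightarrow> 'a \<Rightarrow> 'b) \<Rightarrow> bool"
  where "simplicial_map_upto N X Y f \<longleftrightarrow>
    (\<forall>k. enat k \<le> N \<longrightarrow> f k \<in> simplices X k \<rightarrow>\<^sub>E simplices Y k) \<and>
    (\<forall>k. \<not> enat k \<le> N \<longrightarrow> f k = (\<lambda>_. undefined)) \<and>
    (\<forall>k j x. enat (Suc k) \<le> N \<and> j \<le> Suc k \<and> x \<in> simplices X (Suc k) \<longrightarrow>
      f k (face X (Suc k) j x) = face Y (Suc k) j (f (Suc k) x)) \<and>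
    (\<forall>k j x. enat (Suc k) \<le> N \<and> j \<le> k \<and> x \<in> simplices X k \<longrightarrow>
      f (Suc k) (degen X k j x) = degen Y k j (f k x))"

abbreviation simplicial_map :: "'a sset \<Rightarrow> 'b sset \<Rightarrow> (nat \<Rightarrow> 'a \<Rightarrow> 'b) \<Rightarrow> bool"
  where "simplicial_map \<equiv> simplicial_map_upto \<infinity>"

definition simplicial_iso :: "'a sset \<Rightarrow> 'b sset \<Rightarrow> (nat \<Rightarrow> 'a \<Rightarrow> 'b) \<Rightarrow> bool"
  where "simplicial_iso X Y f \<longleftrightarrow> simplicial_map X Y f \<and>
    (\<exists>g. simplicial_map Y X g \<and>
      (\<forall>k. \<forall>x\<in>simplices X k. g k (f k x) = x) \<and>
      (\<forall>k. \<forall>y\<in>simplices Y k. f k (g k y) = y))"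

definition tr :: "nat \<Rightarrow> 'a sset \<Rightarrow> 'a sset"
  where "tr n X =
    \<lparr>simplices = (\<lambda>k. if k \<le> n then simplices X k else {}),
     face = (\<lambda>k. if k \<le> n then face X k else (\<lambda>_ _. undefined)),
     degen = (\<lambda>k. if k < n then degen X k else (\<lambda>_ _. undefined))\<rparr>"

definition tr_map :: "nat \<Rightarrow> (nat \<Rightarrow> 'a \<Rightarrow> 'b) \<Rightarrow> nat \<Rightarrow> 'a \<Rightarrow> 'b"
  where "tr_map n f k = (if k \<le> n then f k else (\<lambda>_. undefined))"


section \<open>Coskeleta\<close>

text \<open>
  The standard simplex \<open>\<Delta>[m]\<close>: a \<open>k\<close>-simplex is an order-preserving map \<open>[k] \<rightarrow> [m]\<close>, written
  as the list of its \<open>k + 1\<close> values.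
\<close>

definition std_simplex :: "nat \<Rightarrow> nat list sset"
  where "std_simplex m =
    \<lparr>simplices = (\<lambda>k. {\<theta>. length \<theta> = Suc k \<and> sorted \<theta> \<and> set \<theta> \<subseteq> {..m}}),
     face = (\<lambda>k j \<theta>. take j \<theta> @ drop (Suc j) \<theta>),
     degen = (\<lambda>k j \<theta>. take (Suc j) \<theta> @ drop j \<theta>)\<rparr>"

definition top_simplex :: "nat \<Rightarrow> nat list"
  where "top_simplex m = [0..<Suc m]"

text \<open>
  The coface \<open>[m - 1] \<rightarrow> [m]\<close> omitting the value \<open>j\<close> and the codegeneracy \<open>[m + 1] \<rightarrow> [m]\<close>
  taking the value \<open>j\<close> twice. Postcomposing with them gives the maps
  \<open>\<Delta>[m - 1] \<rightarrow> \<Delta>[m]\<close> and \<open>\<Delta>[m + 1] \<rightarrow> \<Delta>[m]\<close>.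
\<close>

definition coface :: "nat \<Rightarrow> nat \<Rightarrow> nat"
  where "coface j v = (if v < j then v else Suc v)"

definition codegen :: "nat \<Rightarrow> nat \<Rightarrow> nat"
  where "codegen j v = (if v \<le> j then v else v - 1)"

text \<open>
  The right adjoint of \<open>tr n\<close> (see \<open>cosk_universal\<close> below). By the Yoneda lemma its
  \<open>m\<close>-simplices have to be the maps from \<open>tr n \<Delta>[m]\<close> to the given \<open>n\<close>-truncated simplicial
  set, the simplicial operators acting by precomposition.
\<close>

definition cosk :: "nat \<Rightarrow> 'a sset \<Rightarrow> (nat \<Rightarrow> nat list \<Rightarrow> 'a) sset"
  where "cosk n T =
    \<lparr>simplices = (\<lambda>m. {f. simplicial_map_upto (enat n) (tr n (std_simplex m)) T f}),
     face = (\<lambda>m j f k.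
       restrict (\<lambda>\<theta>. f k (map (coface j) \<theta>)) (simplices (tr n (std_simplex (m - 1))) k)),
     degen = (\<lambda>m j f k.
       restrict (\<lambda>\<theta>. f k (map (codegen j) \<theta>)) (simplices (tr n (std_simplex (Suc m))) k))\<rparr>"

abbreviation Cosk :: "nat \<Rightarrow> 'a sset \<Rightarrow> (nat \<Rightarrow> nat list \<Rightarrow> 'a) sset"
  where "Cosk n X \<equiv> cosk n (tr n X)"

definition representing_map :: "'a sset \<Rightarrow> nat \<Rightarrow> 'a \<Rightarrow> nat \<Rightarrow> nat list \<Rightarrow> 'a"
  where "representing_map X m x =
    (THE f. simplicial_map (std_simplex m) X f \<and> f m (top_simplex m) = x)"

definition cosk_unit :: "nat \<Rightarrow> 'a sset \<Rightarrow> nat \<Rightarrow> 'a \<Rightarrow> nat \<Rightarrow> nat list \<Rightarrow> 'a"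
  where "cosk_unit n X m = restrict (\<lambda>x. tr_map n (representing_map X m x)) (simplices X m)"

definition coskeletal :: "nat \<Rightarrow> 'a sset \<Rightarrow> bool"
  where "coskeletal n X \<longleftrightarrow> simplicial_set X \<and> simplicial_iso X (Cosk n X) (cosk_unit n X)"


section \<open>Crossed monoids over a small category\<close>

record ('o, 'm) cat =
  Obj :: "'o set"
  Mor :: "'m set"
  src :: "'m \<Rightarrow> 'o"
  tgt :: "'m \<Rightarrow> 'o"
  ident :: "'o \<Rightarrow> 'm"
  cat_comp :: "'m \<Rightarrow> 'm \<Rightarrow> 'm"

definition hom_set :: "('o, 'm) cat \<Rightarrow> 'o \<Rightarrow> 'o \<Rightarrow> 'm set"
  where "hom_set C s t = {\<alpha> \<in> Mor C. src C \<alpha> = s \<and> tgt C \<alpha> = t}"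

text \<open>\<open>cat_comp C \<alpha> \<beta>\<close> is \<open>\<alpha>\<close> after \<open>\<beta>\<close>.\<close>

locale small_category =
  fixes C :: "('o, 'm) cat"
  assumes src_in: "\<alpha> \<in> Mor C \<Longrightarrow> src C \<alpha> \<in> Obj C"
    and tgt_in: "\<alpha> \<in> Mor C \<Longrightarrow> tgt C \<alpha> \<in> Obj C"
    and ident_in: "t \<in> Obj C \<Longrightarrow> ident C t \<in> hom_set C t t"
    and comp_in: "\<lbrakk>\<alpha> \<in> hom_set C s t; \<beta> \<in> hom_set C r s\<rbrakk> \<Longrightarrow> cat_comp C \<alpha> \<beta> \<in> hom_set C r t"
    and comp_assoc: "\<lbrakk>\<alpha> \<in> hom_set C s t; \<beta> \<in> hom_set C r s; \<gamma> \<in> hom_set C q r\<rbrakk>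
      \<Longrightarrow> cat_comp C (cat_comp C \<alpha> \<beta>) \<gamma> = cat_comp C \<alpha> (cat_comp C \<beta> \<gamma>)"
    and ident_left: "\<alpha> \<in> hom_set C s t \<Longrightarrow> cat_comp C (ident C t) \<alpha> = \<alpha>"
    and ident_right: "\<alpha> \<in> hom_set C s t \<Longrightarrow> cat_comp C \<alpha> (ident C s) = \<alpha>"

definition end_monoid :: "('o, 'm) cat \<Rightarrow> 'o \<Rightarrow> 'm monoid"
  where "end_monoid C t = \<lparr>carrier = hom_set C t t, mult = cat_comp C, one = ident C t\<rparr>"

text \<open>The library's \<open>hom\<close> only requires multiplicativity.\<close>

definition monoid_hom :: "'a monoid \<Rightarrow> 'b monoid \<Rightarrow> ('a \<Rightarrow> 'b) \<Rightarrow> bool"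
  where "monoid_hom G H h \<longleftrightarrow> h \<in> hom G H \<and> h \<one>\<^bsub>G\<^esub> = \<one>\<^bsub>H\<^esub>"

text \<open>
  \<open>pull \<alpha> a\<close> is \<open>a\<^sup>\<alpha> = A(\<alpha>)(a)\<close>, and \<open>bd t\<close> is \<open>\<partial>\<^sub>t\<close>. The monoids \<open>A t\<close> for
  different \<open>t\<close> share one type, but their carriers need not be related.
\<close>

locale crossed_monoid = small_category C
  for C :: "('o, 'm) cat" +
  fixes A :: "'o \<Rightarrow> 'a monoid" and pull :: "'m \<Rightarrow> 'a \<Rightarrow> 'a" and bd :: "'o \<Rightarrow> 'a \<Rightarrow> 'm"
  assumes monoid_A: "t \<in> Obj C \<Longrightarrow> monoid (A t)"
    and pull_hom: "\<alpha> \<in> hom_set C s t \<Longrightarrow> monoid_hom (A t) (A s) (pull \<alpha>)"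
    and pull_ident: "\<lbrakk>t \<in> Obj C; a \<in> carrier (A t)\<rbrakk> \<Longrightarrow> pull (ident C t) a = a"
    and pull_comp: "\<lbrakk>\<alpha> \<in> hom_set C s t; \<beta> \<in> hom_set C r s; a \<in> carrier (A t)\<rbrakk>
      \<Longrightarrow> pull (cat_comp C \<alpha> \<beta>) a = pull \<beta> (pull \<alpha> a)"
    and bd_hom: "t \<in> Obj C \<Longrightarrow> monoid_hom (A t) (end_monoid C t) (bd t)"
    and bd_pull: "\<lbrakk>\<alpha> \<in> hom_set C s t; a \<in> carrier (A t)\<rbrakk>
      \<Longrightarrow> cat_comp C \<alpha> (bd s (pull \<alpha> a)) = cat_comp C (bd t a) \<alpha>"
    and peiffer: "\<lbrakk>t \<in> Obj C; a \<in> carrier (A t); b \<in> carrier (A t)\<rbrakk>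
      \<Longrightarrow> a \<otimes>\<^bsub>A t\<^esub> b = b \<otimes>\<^bsub>A t\<^esub> pull (bd t b) a"

definition left_cancellative :: "'a monoid \<Rightarrow> bool"
  where "left_cancellative G \<longleftrightarrow>
    (\<forall>a\<in>carrier G. \<forall>b\<in>carrier G. \<forall>c\<in>carrier G. a \<otimes>\<^bsub>G\<^esub> b = a \<otimes>\<^bsub>G\<^esub> c \<longrightarrow> b = c)"

definition right_cancellative :: "'a monoid \<Rightarrow> bool"
  where "right_cancellative G \<longleftrightarrow>
    (\<forall>a\<in>carrier G. \<forall>b\<in>carrier G. \<forall>c\<in>carrier G. b \<otimes>\<^bsub>G\<^esub> a = c \<otimes>\<^bsub>G\<^esub> a \<longrightarrow> b = c)"


section \<open>The nerve of a crossed monoid\<close>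

text \<open>
  A matrix is stored as its diagonal, with values in the morphisms, together with its entries
  strictly above the diagonal. Both functions are 1-based and \<open>undefined\<close> outside the range of
  the indices, so that equal matrices are equal elements of the type. A morphism
  is identified with the corresponding \<open>1 \<times> 1\<close> matrix, an object with \<open>Vertex\<close>.
\<close>

datatype ('o, 'm, 'a) nerve_simplex = Vertex 'o | Matrix "nat \<Rightarrow> 'm" "nat \<Rightarrow> nat \<Rightarrow> 'a"

definition mk_matrix :: "nat \<Rightarrow> (nat \<Rightarrow> 'm) \<Rightarrow> (nat \<Rightarrow> nat \<Rightarrow> 'a) \<Rightarrow> ('o, 'm, 'a) nerve_simplex"
  where "mk_matrix n d u =
    Matrix (\<lambda>i. if 1 \<le> i \<and> i \<le> n then d i else undefined)
      (\<lambda>i k. if 1 \<le> i \<and> i < k \<and> k \<le> n then u i k else undefined)"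

definition nerve_simplices ::
    "('o, 'm) cat \<Rightarrow> ('o \<Rightarrow> 'a monoid) \<Rightarrow> nat \<Rightarrow> ('o, 'm, 'a) nerve_simplex set"
  where "nerve_simplices C A n =
    (if n = 0 then Vertex ` Obj C
     else {mk_matrix n d u | d u. \<exists>x :: nat \<Rightarrow> 'o.
       (\<forall>j\<le>n. x j \<in> Obj C) \<and>
       (\<forall>j. 1 \<le> j \<and> j \<le> n \<longrightarrow> d j \<in> hom_set C (x j) (x (j - 1))) \<and>
       (\<forall>i j. 1 \<le> i \<and> i < j \<and> j \<le> n \<longrightarrow> u i j \<in> carrier (A (x i)))})"

text \<open>The object \<open>x\<^sub>i\<close> belonging to a matrix with diagonal \<open>d\<close>.\<close>

definition diag_obj :: "('o, 'm) cat \<Rightarrow> (nat \<Rightarrow> 'm) \<Rightarrow> nat \<Rightarrow> 'o"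
  where "diag_obj C d i = (if i = 0 then tgt C (d 1) else src C (d i))"

definition ordered_prod :: "'a monoid \<Rightarrow> 'a list \<Rightarrow> 'a"
  where "ordered_prod G as = foldr (mult G) as \<one>\<^bsub>G\<^esub>"

definition nerve_degen ::
    "('o, 'm) cat \<Rightarrow> ('o \<Rightarrow> 'a monoid) \<Rightarrow> nat \<Rightarrow> nat
      \<Rightarrow> ('o, 'm, 'a) nerve_simplex \<Rightarrow> ('o, 'm, 'a) nerve_simplex"
  where "nerve_degen C A n j M = (case M of
      Vertex p \<Rightarrow> mk_matrix 1 (\<lambda>_. ident C p) (\<lambda>_ _. undefined)
    | Matrix d u \<Rightarrow> (let x = diag_obj C d in
        mk_matrix (Suc n)
          (\<lambda>i. if i \<le> j then d i else if i = Suc j then ident C (x j) else d (i - 1))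
          (\<lambda>i k.
            if i \<le> j then
              (if k \<le> j then u i k else if k = Suc j then \<one>\<^bsub>A (x i)\<^esub> else u i (k - 1))
            else if i = Suc j then \<one>\<^bsub>A (x j)\<^esub>
            else u (i - 1) (k - 1))))"

definition nerve_face ::
    "('o, 'm) cat \<Rightarrow> ('o \<Rightarrow> 'a monoid) \<Rightarrow> ('m \<Rightarrow> 'a \<Rightarrow> 'a) \<Rightarrow> ('o \<Rightarrow> 'a \<Rightarrow> 'm) \<Rightarrow> nat \<Rightarrow> nat
      \<Rightarrow> ('o, 'm, 'a) nerve_simplex \<Rightarrow> ('o, 'm, 'a) nerve_simplex"
  where "nerve_face C A pull bd n j M = (case M of
      Vertex p \<Rightarrow> undefined
    | Matrix d u \<Rightarrow>
        if n = 1 then Vertex (if j = 0 then src C (d 1) else tgt C (d 1))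
        else if j = 0 then mk_matrix (n - 1) (\<lambda>i. d (Suc i)) (\<lambda>i k. u (Suc i) (Suc k))
        else if j = n then mk_matrix (n - 1) d u
        else (let x = diag_obj C d;
            \<eta> = (\<lambda>k. cat_comp C (d (Suc j))
              (bd (x (Suc j)) (ordered_prod (A (x (Suc j))) (map (u (Suc j)) [j + 2..<Suc k])))) in
          mk_matrix (n - 1)
            (\<lambda>i. if i < j then d i
              else if i = j then cat_comp C (d j) (cat_comp C (bd (x j) (u j (Suc j))) (d (Suc j)))
              else d (Suc i))
            (\<lambda>i k.
              if i < j then
                (if k < j then u i k
                 else if k = j then u i j \<otimes>\<^bsub>A (x i)\<^esub> u i (Suc j)
                 else u i (Suc k))
              else if i = j then pull (\<eta> k) (u j (Suc k)) \<otimes>\<^bsub>A (x (Suc j))\<^esub> u (Suc j) (Suc k)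
              else u (Suc i) (Suc k))))"

definition nerve ::
    "('o, 'm) cat \<Rightarrow> ('o \<Rightarrow> 'a monoid) \<Rightarrow> ('m \<Rightarrow> 'a \<Rightarrow> 'a) \<Rightarrow> ('o \<Rightarrow> 'a \<Rightarrow> 'm)
      \<Rightarrow> ('o, 'm, 'a) nerve_simplex sset"
  where "nerve C A pull bd =
    \<lparr>simplices = nerve_simplices C A, face = nerve_face C A pull bd, degen = nerve_degen C A\<rparr>"

section \<open>The adjunction\<close>

text \<open>
  Results relating the explicit coskeleton above to its universal property:
  \<open>representing_map\<close> is well defined (\<open>representing_map_ex1\<close>), \<open>cosk n T\<close> is a
  simplicial set (\<open>simplicial_set_cosk\<close>), evaluation at the top simplices is a universal arrow
  from \<open>tr n\<close> to \<open>T\<close> (\<open>cosk_universal\<close>), and \<open>cosk_unit\<close> is the unit of the resulting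
  adjunction (\<open>cosk_unit_is_unit\<close>).

  A simplex \<open>\<theta>\<close> of \<open>\<Delta>[m]\<close> is determined by the list \<open>cs\<close> of the multiplicities of its values,
  \<open>\<theta> = blocks 0 cs\<close>; \<open>block_op X 0 cs\<close> is the corresponding operator \<open>X\<^sub>m \<rightarrow> X\<^sub>k\<close>, which at each
  value of multiplicity \<open>c\<close> is a face if \<open>c = 0\<close> and a \<open>(c - 1)\<close>-fold degeneracy otherwise.
\<close>

lemma std_simplex_simps:
  "\<theta> \<in> simplices (std_simplex m) k \<longleftrightarrow> length \<theta> = Suc k \<and> sorted \<theta> \<and> set \<theta> \<subseteq> {..m}"
  "face (std_simplex m) k j \<theta> = take j \<theta> @ drop (Suc j) \<theta>"
  "degen (std_simplex m) k j \<theta> = take (Suc j) \<theta> @ drop j \<theta>"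
  by (auto simp: std_simplex_def)

fun blocks :: "nat \<Rightarrow> nat list \<Rightarrow> nat list"
  where "blocks v [] = []"
  | "blocks v (c # cs) = replicate c v @ blocks (Suc v) cs"

fun degen_pow :: "'a sset \<Rightarrow> nat \<Rightarrow> nat \<Rightarrow> nat \<Rightarrow> 'a \<Rightarrow> 'a"
  where "degen_pow X v 0 n y = y"
  | "degen_pow X v (Suc e) n y = degen X (n + e) v (degen_pow X v e n y)"

fun block_op :: "'a sset \<Rightarrow> nat \<Rightarrow> nat list \<Rightarrow> 'a \<Rightarrow> 'a"
  where "block_op X v [] x = x"
  | "block_op X v (c # cs) x = (let y = block_op X (Suc v) cs x; n = v + sum_list cs in
      if c = 0 then face X n v y else degen_pow X v (c - 1) n y)"

lemma length_blocks [simp]: "length (blocks v cs) = sum_list cs"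
  by (induction cs arbitrary: v) auto

lemma set_blocks: "set (blocks v cs) \<subseteq> {v..<v + length cs}"
proof (induction cs arbitrary: v)
  case (Cons c cs)
  from Cons[of "Suc v"] show ?case by (auto split: if_splits)
qed simp

lemma sorted_blocks: "sorted (blocks v cs)"
proof (induction cs arbitrary: v)
  case (Cons c cs)
  from set_blocks[of "Suc v" cs] Cons[of "Suc v"] show ?case
    by (fastforce simp: sorted_append)
qed simp

lemma count_blocks:
  "map (count_list (blocks v cs)) [v..<v + length cs] = cs"
proof (induction cs arbitrary: v)
  case (Cons c cs)
  have v: "v \<notin> set (blocks (Suc v) cs)" using set_blocks[of "Suc v" cs] by auto
  have r: "count_list (replicate c v) w = (if w = v then c else 0)" for w
    by (induction c) auto
  have "map (count_list (blocks v (c # cs))) [Suc v..<Suc v + length cs]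
      = map (count_list (blocks (Suc v) cs)) [Suc v..<Suc v + length cs]"
    by (rule map_cong) (auto simp: r)
  moreover have "[v..<v + length (c # cs)] = v # [Suc v..<Suc v + length cs]"
    using upt_conv_Cons[of v "v + length (c # cs)"] by (simp del: upt_Suc)
  moreover have "count_list (blocks v (c # cs)) v = c" using v by (simp add: r count_list_0_iff)
  ultimately show ?case using Cons[of "Suc v"] by (simp only: list.map)
qed simp

lemma blocks_inj: "length cs = length cs' \<Longrightarrow> blocks v cs = blocks v cs' \<Longrightarrow> cs = cs'"
  using count_blocks by metis

lemma blocks_surj:
  assumes "sorted \<theta>" "set \<theta> \<subseteq> {v..<v + l}"
  shows "\<exists>cs. length cs = l \<and> blocks v cs = \<theta>"
  using assms
proof (induction l arbitrary: v \<theta>)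
  case (Suc l)
  let ?a = "takeWhile (\<lambda>w. w = v) \<theta>" and ?b = "dropWhile (\<lambda>w. w = v) \<theta>"
  have ab: "\<theta> = ?a @ ?b" by simp
  have srt: "sorted ?b" using Suc.prems(1) by (rule sorted_dropWhile)
  have "set ?b \<subseteq> {Suc v..<Suc v + l}"
  proof
    fix w assume w: "w \<in> set ?b"
    then have ne: "?b \<noteq> []" by (rule length_pos_if_in_set[THEN iffD1[OF length_greater_0_conv]])
    have "hd ?b \<noteq> v" using ne hd_dropWhile by blast
    moreover have "hd ?b \<in> set \<theta>" using ne by (meson hd_in_set set_dropWhileD)
    ultimately have "hd ?b > v" using Suc.prems(2) by fastforce
    moreover have "hd ?b \<le> w" using srt w ne by (cases ?b) auto
    moreover have "w \<in> set \<theta>" using w by (rule set_dropWhileD)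
    ultimately show "w \<in> {Suc v..<Suc v + l}" using Suc.prems(2) by fastforce
  qed
  from Suc.IH[OF srt this] obtain cs where cs: "length cs = l" "blocks (Suc v) cs = ?b" by blast
  have "\<forall>w\<in>set ?a. w = v" by (auto dest: set_takeWhileD)
  then have "?a = replicate (length ?a) v" by (simp add: replicate_length_same)
  then have "blocks v (length ?a # cs) = \<theta>" using cs ab by simp
  then show ?case using cs(1) by (intro exI[of _ "length ?a # cs"]) simp
qed simp

lemma blocks_exists:
  assumes "\<theta> \<in> simplices (std_simplex m) k"
  obtains cs where "length cs = Suc m" "sum_list cs = Suc k" "blocks 0 cs = \<theta>"
proof -
  have "sorted \<theta>" "set \<theta> \<subseteq> {0..<0 + Suc m}" "length \<theta> = Suc k"
    using assms by (auto simp: std_simplex_simps)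
  with blocks_surj[of \<theta> 0 "Suc m"] show ?thesis using that by auto
qed

lemma blocks_in:
  assumes "length cs = Suc m" "sum_list cs = Suc k"
  shows "blocks 0 cs \<in> simplices (std_simplex m) k"
  using assms set_blocks[of 0 cs] sorted_blocks[of 0 cs] by (auto simp: std_simplex_simps)

context
  fixes X :: "'a sset"
  assumes X: "simplicial_set X"
begin

interpretation simplicial_set_upto \<infinity> X by (rule X)

lemma degen_pow_in:
  "y \<in> simplices X n \<Longrightarrow> v \<le> n \<Longrightarrow> degen_pow X v e n y \<in> simplices X (n + e)"
  by (induction e) (auto intro: degen_in)

lemma block_op_in:
  assumes "x \<in> simplices X (v + length cs - 1)" "v + sum_list cs > 0" "v + length cs > 0"
  shows "block_op X v cs x \<in> simplices X (v + sum_list cs - 1)"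
  using assms
proof (induction cs arbitrary: v)
  case (Cons c cs)
  have y: "block_op X (Suc v) cs x \<in> simplices X (v + sum_list cs)"
    using Cons.IH[of "Suc v"] Cons.prems by simp
  show ?case
  proof (cases c)
    case 0
    then obtain n where "v + sum_list cs = Suc n" using Cons.prems(2) by (cases "v + sum_list cs") auto
    moreover have "v \<le> Suc n" using calculation by simp
    ultimately show ?thesis using y 0 face_in[of n v] by (simp add: Let_def)
  next
    case (Suc e)
    then show ?thesis using degen_pow_in[OF y, of v e] by (simp add: Let_def add.commute add.left_commute)
  qed
qed simp

lemma face_degen_pow_inside:
  assumes "y \<in> simplices X n" "v \<le> n" "r \<le> Suc e"
  shows "face X (n + Suc e) (v + r) (degen_pow X v (Suc e) n y) = degen_pow X v e n y"
  using assms(3)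
proof (induction e arbitrary: r)
  case 0
  then show ?case using assms face_degen_id[of n v "v + r" y] by (cases r) auto
next
  case (Suc e)
  have z: "degen_pow X v (Suc e) n y \<in> simplices X (Suc (n + e))"
    using degen_pow_in[OF assms(1,2), of "Suc e"] by simp
  show ?case
  proof (cases "r \<le> 1")
    case True
    then show ?thesis
      using z face_degen_id[of "Suc (n + e)" v "v + r" "degen_pow X v (Suc e) n y"] assms(2)
      by (cases r) auto
  next
    case False
    then have "face X (n + Suc (Suc e)) (v + r) (degen_pow X v (Suc (Suc e)) n y)
      = degen X (n + e) v (face X (Suc (n + e)) (v + r - 1) (degen_pow X v (Suc e) n y))"
      using z face_degen_above[of "n + e" v "v + r" "degen_pow X v (Suc e) n y"] assms(2) Suc.prems
      by simp
    also have "v + r - 1 = v + (r - 1)" using False by simp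
    finally show ?thesis using Suc.IH[of "r - 1"] Suc.prems False by simp
  qed
qed

lemma face_degen_pow_above:
  assumes "y \<in> simplices X (Suc n)" "v < i" "i \<le> Suc n"
  shows "face X (Suc n + e) (i + e) (degen_pow X v e (Suc n) y) = degen_pow X v e n (face X (Suc n) i y)"
proof (induction e)
  case (Suc e)
  have "degen_pow X v e (Suc n) y \<in> simplices X (Suc (n + e))"
    using degen_pow_in[OF assms(1), of v e] assms by simp
  then show ?case
    using face_degen_above[of "n + e" v "i + Suc e" "degen_pow X v e (Suc n) y"] assms Suc by simp
qed simp

lemma degen_degen_pow_inside:
  assumes "y \<in> simplices X n" "v \<le> n" "r \<le> e"
  shows "degen X (n + e) (v + r) (degen_pow X v e n y) = degen_pow X v (Suc e) n y"
  using assms(3)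
proof (induction e arbitrary: r)
  case (Suc e)
  have z: "degen_pow X v e n y \<in> simplices X (n + e)"
    using degen_pow_in[OF assms(1,2)] .
  show ?case
  proof (cases r)
    case (Suc r')
    have "degen X (Suc (n + e)) v (degen X (n + e) (v + r') (degen_pow X v e n y))
      = degen X (Suc (n + e)) (Suc (v + r')) (degen X (n + e) v (degen_pow X v e n y))"
      using degen_degen[of "n + e" v "v + r'"] z Suc Suc.prems assms(2) by simp
    then show ?thesis using Suc Suc.IH[of r'] Suc.prems by simp
  qed simp
qed simp

lemma degen_degen_pow_above:
  assumes "y \<in> simplices X n" "v < i" "i \<le> n"
  shows "degen X (n + e) (i + e) (degen_pow X v e n y) = degen_pow X v e (Suc n) (degen X n i y)"
proof (induction e)
  case (Suc e)
  have z: "degen_pow X v e n y \<in> simplices X (n + e)"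
    using degen_pow_in[OF assms(1)] assms by simp
  show ?case
    using degen_degen[of "n + e" v "i + e" "degen_pow X v e n y"] z assms Suc by simp
qed simp

lemma block_op_face:
  assumes "x \<in> simplices X (v + length cs - 1)" "v + sum_list cs > 1" "j < sum_list cs"
  shows "\<exists>cs'. length cs' = length cs \<and> Suc (sum_list cs') = sum_list cs \<and>
    blocks v cs' = take j (blocks v cs) @ drop (Suc j) (blocks v cs) \<and>
    block_op X v cs' x = face X (v + sum_list cs - 1) (v + j) (block_op X v cs x)"
  using assms
proof (induction cs arbitrary: v j)
  case (Cons c cs)
  let ?y = "block_op X (Suc v) cs x"
  have y: "?y \<in> simplices X (v + sum_list cs)"
    using block_op_in[of x "Suc v" cs] Cons.prems by simp
  show ?case
  proof (cases "j < c")
    case True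
    then obtain e where e: "c = Suc e" by (cases c) auto
    have "blocks v (e # cs) = take j (blocks v (c # cs)) @ drop (Suc j) (blocks v (c # cs))"
      using True e by (simp add: replicate_add[symmetric] del: replicate_Suc)
    moreover have "block_op X v (e # cs) x
      = face X (v + sum_list (c # cs) - 1) (v + j) (block_op X v (c # cs) x)"
    proof (cases e)
      case 0
      then show ?thesis using True e by (simp add: Let_def)
    next
      case (Suc e')
      then show ?thesis
        using face_degen_pow_inside[OF y, of v j e'] True e
        by (simp add: Let_def ac_simps)
    qed
    ultimately show ?thesis using e by (intro exI[of _ "e # cs"]) simp
  next
    case False
    then have j: "j - c < sum_list cs" using Cons.prems by simp
    obtain n where n: "v + sum_list cs = Suc n" using j by (cases "v + sum_list cs") auto
    from Cons.IH[of "Suc v" "j - c"] Cons.prems j n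
    obtain cs' where cs': "length cs' = length cs" "Suc (sum_list cs') = sum_list cs"
      "blocks (Suc v) cs' = take (j - c) (blocks (Suc v) cs) @ drop (Suc (j - c)) (blocks (Suc v) cs)"
      "block_op X (Suc v) cs' x = face X (Suc n) (Suc v + (j - c)) ?y"
      by auto
    have y': "?y \<in> simplices X (Suc n)" using y n by simp
    have n': "v + sum_list cs' = n" using n cs' by simp
    have i: "Suc v + (j - c) \<le> Suc n" using j n by simp
    have "blocks v (c # cs') = take j (blocks v (c # cs)) @ drop (Suc j) (blocks v (c # cs))"
      using False cs' by (simp add: Suc_diff_le)
    moreover have "block_op X v (c # cs') x
      = face X (v + sum_list (c # cs) - 1) (v + j) (block_op X v (c # cs) x)"
    proof (cases c)
      case 0
      obtain n0 where n0: "n = Suc n0" using Cons.prems(2) 0 n by (cases n) auto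
      have "face X (Suc n0) v (face X (Suc (Suc n0)) (Suc (v + j)) ?y)
        = face X (Suc n0) (v + j) (face X (Suc (Suc n0)) v ?y)"
        using face_face[of n0 v "Suc (v + j)" ?y] y' n0 i 0 by simp
      then show ?thesis using 0 cs' n n' n0 by (simp add: Let_def)
    next
      case (Suc e)
      then have "v + j = Suc v + (j - c) + e" using False by simp
      then show ?thesis
        using Suc face_degen_pow_above[OF y', of v "Suc v + (j - c)" e] i cs' n n'
        by (simp add: Let_def ac_simps)
    qed
    ultimately show ?thesis using cs' by (intro exI[of _ "c # cs'"]) simp
  qed
qed simp

lemma block_op_degen:
  assumes "x \<in> simplices X (v + length cs - 1)" "j < sum_list cs"
  shows "\<exists>cs'. length cs' = length cs \<and> sum_list cs' = Suc (sum_list cs) \<and>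
    blocks v cs' = take (Suc j) (blocks v cs) @ drop j (blocks v cs) \<and>
    block_op X v cs' x = degen X (v + sum_list cs - 1) (v + j) (block_op X v cs x)"
  using assms
proof (induction cs arbitrary: v j)
  case (Cons c cs)
  let ?y = "block_op X (Suc v) cs x"
  have y: "?y \<in> simplices X (v + sum_list cs)"
    using block_op_in[of x "Suc v" cs] Cons.prems by simp
  show ?case
  proof (cases "j < c")
    case True
    then obtain e where e: "c = Suc e" by (cases c) auto
    have "replicate (Suc c) v = replicate (Suc j) v @ replicate (c - j) v"
      using True by (simp flip: replicate_add replicate_Suc)
    then have "blocks v (Suc c # cs) = take (Suc j) (blocks v (c # cs)) @ drop j (blocks v (c # cs))"
      using True by (simp add: min_def del: replicate_Suc)
    moreover have "block_op X v (Suc c # cs) x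
      = degen X (v + sum_list (c # cs) - 1) (v + j) (block_op X v (c # cs) x)"
      using degen_degen_pow_inside[OF y, of v j e] True e by (simp add: Let_def ac_simps)
    ultimately show ?thesis by (intro exI[of _ "Suc c # cs"]) simp
  next
    case False
    then have j: "j - c < sum_list cs" using Cons.prems by simp
    let ?n = "v + sum_list cs"
    from Cons.IH[of "Suc v" "j - c"] Cons.prems j
    obtain cs' where cs': "length cs' = length cs" "sum_list cs' = Suc (sum_list cs)"
      "blocks (Suc v) cs' = take (Suc (j - c)) (blocks (Suc v) cs) @ drop (j - c) (blocks (Suc v) cs)"
      "block_op X (Suc v) cs' x = degen X ?n (Suc v + (j - c)) ?y"
      by auto
    have i: "Suc v + (j - c) \<le> ?n" using j by simp
    have "blocks v (c # cs') = take (Suc j) (blocks v (c # cs)) @ drop j (blocks v (c # cs))"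
      using False cs' by (simp add: Suc_diff_le)
    moreover have "block_op X v (c # cs') x
      = degen X (v + sum_list (c # cs) - 1) (v + j) (block_op X v (c # cs) x)"
    proof (cases c)
      case 0
      obtain n0 where n0: "?n = Suc n0" using i by (cases ?n) auto
      have "face X (Suc (Suc n0)) v (degen X (Suc n0) (Suc (v + j)) ?y)
        = degen X n0 (v + j) (face X (Suc n0) v ?y)"
        using face_degen_below[of n0 v "Suc (v + j)" ?y] y n0 i 0 by simp
      then show ?thesis using 0 cs' n0 by (simp add: Let_def)
    next
      case (Suc e)
      then have "v + j = Suc v + (j - c) + e" using False by simp
      then show ?thesis
        using Suc degen_degen_pow_above[OF y, of v "Suc v + (j - c)" e] i cs'
        by (simp add: Let_def ac_simps)
    qed
    ultimately show ?thesis using cs' by (intro exI[of _ "c # cs'"]) simp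
  qed
qed simp

end

lemma simplicial_map_in:
  "simplicial_map_upto N X Y f \<Longrightarrow> enat k \<le> N \<Longrightarrow> x \<in> simplices X k \<Longrightarrow> f k x \<in> simplices Y k"
  by (auto simp: simplicial_map_upto_def)

lemma simplicial_map_face:
  "simplicial_map_upto N X Y f \<Longrightarrow> enat (Suc k) \<le> N \<Longrightarrow> j \<le> Suc k \<Longrightarrow> x \<in> simplices X (Suc k)
    \<Longrightarrow> f k (face X (Suc k) j x) = face Y (Suc k) j (f (Suc k) x)"
  by (auto simp: simplicial_map_upto_def)

lemma simplicial_map_degen:
  "simplicial_map_upto N X Y f \<Longrightarrow> enat (Suc k) \<le> N \<Longrightarrow> j \<le> k \<Longrightarrow> x \<in> simplices X k
    \<Longrightarrow> f (Suc k) (degen X k j x) = degen Y k j (f k x)"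
  by (auto simp: simplicial_map_upto_def)

lemma simplicial_map_eqI:
  assumes "simplicial_map_upto N X Y f" "simplicial_map_upto N X Y g"
    and "\<And>k x. enat k \<le> N \<Longrightarrow> x \<in> simplices X k \<Longrightarrow> f k x = g k x"
  shows "f = g"
proof
  fix k
  show "f k = g k"
  proof (cases "enat k \<le> N")
    case True
    then have "f k \<in> simplices X k \<rightarrow>\<^sub>E simplices Y k" "g k \<in> simplices X k \<rightarrow>\<^sub>E simplices Y k"
      using assms by (auto simp: simplicial_map_upto_def)
    then show ?thesis using assms(3)[OF True] by (intro PiE_ext) auto
  next
    case False
    then show ?thesis using assms by (auto simp: simplicial_map_upto_def)
  qed
qed

lemma enat_Suc_leD: "enat (Suc k) \<le> N \<Longrightarrow> enat k \<le> N"
  by (meson enat_ord_simps(1) le_SucI order_refl order_trans)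

lemma simplicial_map_tr:
  "simplicial_map_upto (enat n) (tr n X) (tr n Y) f \<longleftrightarrow> simplicial_map_upto (enat n) X Y f"
  "simplicial_map_upto (enat n) (tr n X) Z f \<longleftrightarrow> simplicial_map_upto (enat n) X Z f"
  by (auto simp: simplicial_map_upto_def tr_def)

lemma simplices_tr: "y \<in> simplices (tr n Z) k \<longleftrightarrow> k \<le> n \<and> y \<in> simplices Z k"
  by (simp add: tr_def)

lemma simplicial_set_tr: "simplicial_set X \<Longrightarrow> simplicial_set_upto (enat n) (tr n X)"
  by (auto simp: simplicial_set_upto_def tr_def)

lemma simplicial_map_tr_map:
  "simplicial_map X Y f \<Longrightarrow> simplicial_map_upto (enat n) (tr n X) (tr n Y) (tr_map n f)"
  by (auto simp: simplicial_map_upto_def tr_map_def tr_def)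

definition smap_comp :: "enat \<Rightarrow> 'a sset \<Rightarrow> (nat \<Rightarrow> 'b \<Rightarrow> 'c) \<Rightarrow> (nat \<Rightarrow> 'a \<Rightarrow> 'b) \<Rightarrow> nat \<Rightarrow> 'a \<Rightarrow> 'c"
  where "smap_comp N X g f k =
    (if enat k \<le> N then restrict (\<lambda>x. g k (f k x)) (simplices X k) else (\<lambda>_. undefined))"

lemma simplicial_map_comp:
  assumes X: "simplicial_set_upto M X" and "N \<le> M" 
    and f: "simplicial_map_upto M X Y f" and g: "simplicial_map_upto N Y Z g"
  shows "simplicial_map_upto N X Z (smap_comp N X g f)"
proof -
  interpret simplicial_set_upto M X by (rule X)
  have M: "enat k \<le> M" if "enat k \<le> N" for k using that assms(2) by order
  show ?thesis
    unfolding simplicial_map_upto_def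
    using simplicial_map_in[OF f M] simplicial_map_face[OF f M] simplicial_map_degen[OF f M]
      simplicial_map_in[OF g] simplicial_map_face[OF g] simplicial_map_degen[OF g]
      face_in[OF M] degen_in[OF M]
    by (auto simp: smap_comp_def dest: enat_Suc_leD)
qed

lemma block_op_map:
  assumes X: "simplicial_set X" and Y: "simplicial_set Y" and f: "simplicial_map X Y f"
    and "x \<in> simplices X (v + length cs - 1)" "v + sum_list cs > 0" "v + length cs > 0"
  shows "f (v + sum_list cs - 1) (block_op X v cs x)
    = block_op Y v cs (f (v + length cs - 1) x)"
  using assms(4-)
proof (induction cs arbitrary: v)
  case (Cons c cs)
  let ?y = "block_op X (Suc v) cs x"
  have y: "?y \<in> simplices X (v + sum_list cs)"
    using block_op_in[OF X, of x "Suc v" cs] Cons.prems by simp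
  have IH: "f (v + sum_list cs) ?y = block_op Y (Suc v) cs (f (v + length cs) x)"
    using Cons.IH[of "Suc v"] Cons.prems by simp
  have pow: "f (n + e) (degen_pow X v e n y) = degen_pow Y v e n (f n y)"
    if "y \<in> simplices X n" "v \<le> n" for y n e
  proof (induction e)
    case (Suc e)
    then show ?case
      using simplicial_map_degen[OF f, of "n + e" v "degen_pow X v e n y"]
        degen_pow_in[OF X that, of e] that(2) by simp
  qed simp
  show ?case
  proof (cases c)
    case 0
    then obtain n where n: "v + sum_list cs = Suc n" using Cons.prems(2) by (cases "v + sum_list cs") auto
    then have "v \<le> Suc n" by simp
    then show ?thesis using y 0 n simplicial_map_face[OF f, of n v ?y] IH by (simp add: Let_def)
  next
    case (Suc e)
    then show ?thesis using pow[OF y, of e] IH by (simp add: Let_def ac_simps)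
  qed
qed simp

lemma nth_del:
  "j < length xs \<Longrightarrow> l < length xs - 1 \<Longrightarrow> (take j xs @ drop (Suc j) xs) ! l = xs ! coface j l"
  by (auto simp: coface_def nth_append min_def)

lemma nth_dup:
  "j < length xs \<Longrightarrow> l < Suc (length xs) \<Longrightarrow> (take (Suc j) xs @ drop j xs) ! l = xs ! codegen j l"
  by (cases "length xs = Suc j") (auto simp: codegen_def nth_append min_def less_Suc_eq)

lemma coface_codegen:
  "i < j \<Longrightarrow> coface j (coface i v) = coface i (coface (j - 1) v)"
  "i \<le> j \<Longrightarrow> codegen j (codegen i v) = codegen i (codegen (Suc j) v)"
  "i < j \<Longrightarrow> codegen j (coface i v) = coface i (codegen (j - 1) v)"
  "i = j \<or> i = Suc j \<Longrightarrow> codegen j (coface i v) = v"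
  "Suc j < i \<Longrightarrow> codegen j (coface i v) = coface (i - 1) (codegen j v)"
  by (auto simp: coface_def codegen_def)

lemma coface_le: "v \<le> m \<Longrightarrow> coface j v \<le> Suc m"
  by (auto simp: coface_def)

lemma codegen_le: "v \<le> Suc m \<Longrightarrow> j \<le> m \<Longrightarrow> codegen j v \<le> m"
  by (auto simp: codegen_def)

lemma mono_coface: "mono (coface j)"
  by (auto simp: coface_def mono_def)

lemma mono_codegen: "mono (codegen j)"
  by (auto simp: codegen_def mono_def)

lemma simplicial_set_std: "simplicial_set (std_simplex m)"
proof -
  let ?S = "simplices (std_simplex m)"
  note d = nth_del nth_dup coface_le codegen_le less_Suc_eq_le
  have len: "length \<theta> = Suc k" if "\<theta> \<in> ?S k" for \<theta> k using that by (simp add: std_simplex_simps)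
  have fi: "face (std_simplex m) (Suc k) j \<theta> \<in> ?S k" if "j \<le> Suc k" "\<theta> \<in> ?S (Suc k)" for k j \<theta>
    using that set_take_subset[of j \<theta>] set_drop_subset[of "Suc j" \<theta>]
      monoD[OF mono_coface[of j]] coface_le[of _ k j]
    by (auto simp: std_simplex_simps sorted_iff_nth_mono nth_del less_Suc_eq_le)
  have di: "degen (std_simplex m) k j \<theta> \<in> ?S (Suc k)" if "j \<le> k" "\<theta> \<in> ?S k" for k j \<theta>
    using that set_take_subset[of "Suc j" \<theta>] set_drop_subset[of j \<theta>]
      monoD[OF mono_codegen[of j]] codegen_le[of _ k j]
    by (auto simp: std_simplex_simps sorted_iff_nth_mono nth_dup less_Suc_eq_le)
  have fn: "length (face (std_simplex m) (Suc k) j \<theta>) = Suc k"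
    "l \<le> k \<Longrightarrow> face (std_simplex m) (Suc k) j \<theta> ! l = \<theta> ! coface j l"
    if "j \<le> Suc k" "length \<theta> = Suc (Suc k)" for k j l \<theta>
    using that nth_del[of j \<theta> l] by (auto simp: std_simplex_simps)
  have dn: "length (degen (std_simplex m) k j \<theta>) = Suc (Suc k)"
    "l \<le> Suc k \<Longrightarrow> degen (std_simplex m) k j \<theta> ! l = \<theta> ! codegen j l"
    if "j \<le> k" "length \<theta> = Suc k" for k j l \<theta>
    using that nth_dup[of j \<theta> l] by (auto simp: std_simplex_simps)
  show ?thesis
  proof
    fix n j \<theta> assume "j \<le> Suc n" "\<theta> \<in> ?S (Suc n)"
    then show "face (std_simplex m) (Suc n) j \<theta> \<in> ?S n" by (rule fi)
  next
    fix n j \<theta> assume "j \<le> n" "\<theta> \<in> ?S n"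
    then show "degen (std_simplex m) n j \<theta> \<in> ?S (Suc n)" by (rule di)
  next
    fix n i j \<theta> assume "i < j" "j \<le> Suc (Suc n)" "\<theta> \<in> ?S (Suc (Suc n))"
    then show "face (std_simplex m) (Suc n) i (face (std_simplex m) (Suc (Suc n)) j \<theta>)
      = face (std_simplex m) (Suc n) (j - 1) (face (std_simplex m) (Suc (Suc n)) i \<theta>)"
      by (intro nth_equalityI) (auto simp: fn coface_le coface_codegen(1) len less_Suc_eq_le)
  next
    fix n i j \<theta> assume "i \<le> j" "j \<le> n" "\<theta> \<in> ?S n"
    then show "degen (std_simplex m) (Suc n) i (degen (std_simplex m) n j \<theta>)
      = degen (std_simplex m) (Suc n) (Suc j) (degen (std_simplex m) n i \<theta>)"
      by (intro nth_equalityI) (auto simp: dn codegen_le coface_codegen(2) len less_Suc_eq_le)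
  next
    fix n i j \<theta> assume "i < j" "j \<le> Suc n" "\<theta> \<in> ?S (Suc n)"
    then show "face (std_simplex m) (Suc (Suc n)) i (degen (std_simplex m) (Suc n) j \<theta>)
      = degen (std_simplex m) n (j - 1) (face (std_simplex m) (Suc n) i \<theta>)"
      by (intro nth_equalityI) (auto simp: fn dn codegen_le coface_le coface_codegen(3) len less_Suc_eq_le)
  next
    fix n i j \<theta> assume "j \<le> n" "i = j \<or> i = Suc j" "\<theta> \<in> ?S n"
    then show "face (std_simplex m) (Suc n) i (degen (std_simplex m) n j \<theta>) = \<theta>"
      by (intro nth_equalityI) (auto simp: fn dn codegen_le coface_le coface_codegen(4) len less_Suc_eq_le)
  next
    fix n i j \<theta> assume "Suc j < i" "i \<le> Suc (Suc n)" "\<theta> \<in> ?S (Suc n)"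
    then show "face (std_simplex m) (Suc (Suc n)) i (degen (std_simplex m) (Suc n) j \<theta>)
      = degen (std_simplex m) n j (face (std_simplex m) (Suc n) (i - 1) \<theta>)"
      by (intro nth_equalityI) (auto simp: fn dn codegen_le coface_le coface_codegen(5) len less_Suc_eq_le)
  qed
qed

lemma block_op_top:
  "block_op (std_simplex m) v cs [0..<v + length cs] = [0..<v] @ blocks v cs"
proof (induction cs arbitrary: v)
  case (Cons c cs)
  have IH: "block_op (std_simplex m) (Suc v) cs [0..<v + length (c # cs)]
    = [0..<v] @ v # blocks (Suc v) cs"
    using Cons[of "Suc v"] by simp
  have pow: "degen_pow (std_simplex m) v e n ([0..<v] @ v # T) = [0..<v] @ replicate (Suc e) v @ T"
    for e n T
  proof (induction e)
    case (Suc e)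
    then show ?case by (simp add: std_simplex_simps)
  qed simp
  show ?case
    unfolding block_op.simps IH Let_def
    using pow[of "c - 1" _ "blocks (Suc v) cs"] by (cases c) (simp_all add: std_simplex_simps)
qed simp

lemma top_simplex_in: "top_simplex m \<in> simplices (std_simplex m) m"
  by (auto simp: std_simplex_simps top_simplex_def simp del: upt_Suc)

lemma simplicial_map_std_eq:
  assumes X: "simplicial_set X" and f: "simplicial_map (std_simplex m) X f"
    and cs: "length cs = Suc m" "sum_list cs = Suc k"
  shows "f k (blocks 0 cs) = block_op X 0 cs (f m (top_simplex m))"
  using block_op_map[OF simplicial_set_std X f, of "top_simplex m" 0 cs] top_simplex_in[of m]
    block_op_top[of m 0 cs] cs
  by (simp add: top_simplex_def)

theorem representing_map_ex1:
  assumes X: "simplicial_set X" and x: "x \<in> simplices X m"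
  shows "\<exists>!f. simplicial_map (std_simplex m) X f \<and> f m (top_simplex m) = x"
proof (rule ex_ex1I)
  let ?S = "simplices (std_simplex m)"
  define c where "c \<theta> = (SOME cs. length cs = Suc m \<and> blocks 0 cs = \<theta>)" for \<theta>
  have c: "c (blocks 0 cs) = cs" if "length cs = Suc m" for cs
    unfolding c_def using that blocks_inj by (intro some_equality) auto
  define f where "f k = restrict (\<lambda>\<theta>. block_op X 0 (c \<theta>) x) (?S k)" for k
  have f: "f k (blocks 0 cs) = block_op X 0 cs x" if "length cs = Suc m" "sum_list cs = Suc k" for cs k
    using that c blocks_in by (simp add: f_def)
  have "simplicial_map (std_simplex m) X f"
    unfolding simplicial_map_upto_def
  proof (intro conjI allI impI; (elim conjE)?)
    fix k
    show "f k \<in> ?S k \<rightarrow>\<^sub>E simplices X k"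
    proof (intro PiE_I)
      fix \<theta> assume "\<theta> \<in> ?S k"
      then obtain cs where "length cs = Suc m" "sum_list cs = Suc k" "blocks 0 cs = \<theta>"
        by (rule blocks_exists)
      then show "f k \<theta> \<in> simplices X k" using f block_op_in[OF X, of x 0 cs] x by auto
    qed (simp add: f_def)
  next
    fix k j \<theta> assume j: "j \<le> Suc k" and "\<theta> \<in> ?S (Suc k)"
    then obtain cs where cs: "length cs = Suc m" "sum_list cs = Suc (Suc k)" "blocks 0 cs = \<theta>"
      using blocks_exists by metis
    with block_op_face[OF X, of x 0 cs j] x j obtain cs' where
      "length cs' = Suc m" "sum_list cs' = Suc k" "blocks 0 cs' = take j \<theta> @ drop (Suc j) \<theta>"
      "block_op X 0 cs' x = face X (Suc k) j (block_op X 0 cs x)" by auto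
    then show "f k (face (std_simplex m) (Suc k) j \<theta>) = face X (Suc k) j (f (Suc k) \<theta>)"
      using f[of cs "Suc k"] f[of cs' k] cs by (simp add: std_simplex_simps)
  next
    fix k j \<theta> assume j: "j \<le> k" and "\<theta> \<in> ?S k"
    then obtain cs where cs: "length cs = Suc m" "sum_list cs = Suc k" "blocks 0 cs = \<theta>"
      using blocks_exists by metis
    with block_op_degen[OF X, of x 0 cs j] x j obtain cs' where
      "length cs' = Suc m" "sum_list cs' = Suc (Suc k)" "blocks 0 cs' = take (Suc j) \<theta> @ drop j \<theta>"
      "block_op X 0 cs' x = degen X k j (block_op X 0 cs x)" by auto
    then show "f (Suc k) (degen (std_simplex m) k j \<theta>) = degen X k j (f k \<theta>)"
      using f[of cs k] f[of cs' "Suc k"] cs by (simp add: std_simplex_simps)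
  qed simp
  moreover have "f m (top_simplex m) = x"
  proof -
    have b: "blocks v (replicate l 1) = [v..<v + l]" for v l
      by (induction l arbitrary: v) (simp_all add: upt_conv_Cons del: upt_Suc)
    have o: "block_op X v (replicate l 1) x = x" for v l
      by (induction l arbitrary: v) (simp_all add: Let_def)
    show ?thesis
      using f[of "replicate (Suc m) 1" m] b[of 0 "Suc m"] o[of 0 "Suc m"]
      by (simp add: top_simplex_def sum_list_replicate del: upt_Suc replicate_Suc)
  qed
  ultimately show "\<exists>f. simplicial_map (std_simplex m) X f \<and> f m (top_simplex m) = x" by blast
next
  fix f g
  assume f: "simplicial_map (std_simplex m) X f \<and> f m (top_simplex m) = x"
    and g: "simplicial_map (std_simplex m) X g \<and> g m (top_simplex m) = x"
  show "f = g"
  proof (rule simplicial_map_eqI)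
    fix k \<theta> assume "\<theta> \<in> simplices (std_simplex m) k"
    then show "f k \<theta> = g k \<theta>"
      using blocks_exists simplicial_map_std_eq[OF X] f g by metis
  qed (use f g in auto)
qed


lemma representing_map:
  assumes "simplicial_set X" and "x \<in> simplices X m"
  shows "simplicial_map (std_simplex m) X (representing_map X m x)"
    and "representing_map X m x m (top_simplex m) = x"
  using theI'[OF representing_map_ex1[OF assms]] by (auto simp: representing_map_def)

lemma representing_map_unique:
  assumes "simplicial_set X" and "x \<in> simplices X m"
    and "simplicial_map (std_simplex m) X f" and "f m (top_simplex m) = x"
  shows "representing_map X m x = f"
  using representing_map[OF assms(1,2)] representing_map_ex1[OF assms(1,2)] assms(3,4) by blast

definition precomp :: "enat \<Rightarrow> (nat \<Rightarrow> nat) \<Rightarrow> nat \<Rightarrow> (nat \<Rightarrow> nat list \<Rightarrow> 'a) \<Rightarrow> nat \<Rightarrow> nat list \<Rightarrow> 'a"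
  where "precomp N h m f k = (if enat k \<le> N
    then restrict (\<lambda>\<theta>. f k (map h \<theta>)) (simplices (std_simplex m) k) else (\<lambda>_. undefined))"

lemma map_std_in:
  assumes "mono_on {..m'} h" "h ` {..m'} \<subseteq> {..m}" "\<theta> \<in> simplices (std_simplex m') k"
  shows "map h \<theta> \<in> simplices (std_simplex m) k"
  using assms
  by (force simp: std_simplex_simps sorted_iff_nth_mono mono_on_def subset_iff image_subset_iff)

lemma simplicial_map_precomp:
  assumes h: "mono_on {..m'} h" "h ` {..m'} \<subseteq> {..m}"
    and f: "simplicial_map_upto N (std_simplex m) Y f"
  shows "simplicial_map_upto N (std_simplex m') Y (precomp N h m' f)"
proof -
  interpret simplicial_set_upto \<infinity> "std_simplex m'" by (rule simplicial_set_std)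
  have "map h (face (std_simplex m') k j \<theta>) = face (std_simplex m) k j (map h \<theta>)"
    "map h (degen (std_simplex m') k j \<theta>) = degen (std_simplex m) k j (map h \<theta>)" for k j \<theta>
    by (auto simp: std_simplex_simps take_map drop_map)
  then show ?thesis
    unfolding simplicial_map_upto_def
    using simplicial_map_in[OF f _ map_std_in[OF h]] simplicial_map_face[OF f _ _ map_std_in[OF h]]
      simplicial_map_degen[OF f _ _ map_std_in[OF h]] face_in degen_in
    by (auto simp: precomp_def dest: enat_Suc_leD)
qed

lemma precomp_precomp:
  assumes "mono_on {..m''} h'" "h' ` {..m''} \<subseteq> {..m'}"
  shows "precomp N h' m'' (precomp N h m' f) = precomp N (h \<circ> h') m'' f"
  using map_std_in[OF assms] by (auto simp: precomp_def fun_eq_iff restrict_def)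

lemma precomp_cong:
  assumes "\<And>v. v \<le> m \<Longrightarrow> h v = h' v"
  shows "precomp N h m f = precomp N h' m f"
proof -
  have "map h \<theta> = map h' \<theta>" if "\<theta> \<in> simplices (std_simplex m) k" for \<theta> k
    using that assms by (auto simp: std_simplex_simps)
  then show ?thesis by (auto simp: precomp_def fun_eq_iff restrict_def simp del: map_eq_conv)
qed

lemma precomp_id:
  assumes "simplicial_map_upto N (std_simplex m) Y f"
  shows "precomp N (\<lambda>v. v) m f = f"
  by (rule simplicial_map_eqI[OF simplicial_map_precomp[OF _ _ assms] assms])
    (auto simp: mono_on_def precomp_def)

lemma cosk_simps:
  "simplices (cosk n T) m = {f. simplicial_map_upto (enat n) (std_simplex m) T f}"
  "face (cosk n T) (Suc m) j f = precomp (enat n) (coface j) m f"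
  "degen (cosk n T) m j f = precomp (enat n) (codegen j) (Suc m) f"
  by (simp add: cosk_def simplicial_map_tr) (auto simp: cosk_def precomp_def tr_def fun_eq_iff)

lemma coface_mono_on: "mono_on A (coface j)" "coface j ` {..m} \<subseteq> {..Suc m}"
  using mono_coface[of j] coface_le[of _ m j] by (auto simp: mono_on_def mono_def)

lemma codegen_mono_on: "mono_on A (codegen j)" "j \<le> m \<Longrightarrow> codegen j ` {..Suc m} \<subseteq> {..m}"
  using mono_codegen[of j] codegen_le[of _ m j] by (auto simp: mono_on_def mono_def)

theorem simplicial_set_cosk: "simplicial_set (cosk n T)"
proof
  fix m j x assume "x \<in> simplices (cosk n T) (Suc m)"
  then show "face (cosk n T) (Suc m) j x \<in> simplices (cosk n T) m"
    using simplicial_map_precomp[OF coface_mono_on] by (simp add: cosk_simps)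
next
  fix m j x assume "x \<in> simplices (cosk n T) m" "j \<le> m"
  then show "degen (cosk n T) m j x \<in> simplices (cosk n T) (Suc m)"
    using simplicial_map_precomp[OF codegen_mono_on] by (simp add: cosk_simps)
qed (auto simp: cosk_simps precomp_precomp[OF coface_mono_on] precomp_precomp[OF codegen_mono_on] coface_codegen precomp_id
      o_def
    intro!: precomp_cong)

lemma map_coface_top:
  assumes "j \<le> Suc k"
  shows "map (coface j) (top_simplex k) = face (std_simplex m) (Suc k) j (top_simplex (Suc k))"
proof (rule nth_equalityI)
  fix i assume "i < length (map (coface j) (top_simplex k))"
  then show "map (coface j) (top_simplex k) ! i = face (std_simplex m) (Suc k) j (top_simplex (Suc k)) ! i"
    using assms nth_del[of j "[0..<Suc (Suc k)]" i] coface_le[of i k j]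
    by (simp add: std_simplex_simps top_simplex_def less_Suc_eq_le del: upt_Suc)
qed (use assms in \<open>simp add: std_simplex_simps top_simplex_def del: upt_Suc\<close>)

lemma map_codegen_top:
  assumes "j \<le> k"
  shows "map (codegen j) (top_simplex (Suc k)) = degen (std_simplex m) k j (top_simplex k)"
proof (rule nth_equalityI)
  fix i assume "i < length (map (codegen j) (top_simplex (Suc k)))"
  then show "map (codegen j) (top_simplex (Suc k)) ! i = degen (std_simplex m) k j (top_simplex k) ! i"
    using assms nth_dup[of j "[0..<Suc k]" i] codegen_le[of i k j]
    by (simp add: std_simplex_simps top_simplex_def less_Suc_eq_le del: upt_Suc)
qed (use assms in \<open>simp add: std_simplex_simps top_simplex_def del: upt_Suc\<close>)

lemma representing_map_face:
  assumes X: "simplicial_set X" and x: "x \<in> simplices X (Suc m)" and j: "j \<le> Suc m"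
  shows "representing_map X m (face X (Suc m) j x) = precomp \<infinity> (coface j) m (representing_map X (Suc m) x)"
proof (rule representing_map_unique[OF X])
  let ?r = "representing_map X (Suc m) x"
  interpret simplicial_set_upto \<infinity> X by (rule X)
  show "face X (Suc m) j x \<in> simplices X m" using face_in x j by simp
  show "simplicial_map (std_simplex m) X (precomp \<infinity> (coface j) m ?r)"
    by (rule simplicial_map_precomp[OF coface_mono_on representing_map(1)[OF X x]])
  show "precomp \<infinity> (coface j) m ?r m (top_simplex m) = face X (Suc m) j x"
    using simplicial_map_face[OF representing_map(1)[OF X x], of m j "top_simplex (Suc m)"]
      representing_map(2)[OF X x] j top_simplex_in map_coface_top[OF j]
    by (simp add: precomp_def)
qed

lemma representing_map_degen:
  assumes X: "simplicial_set X" and x: "x \<in> simplices X m" and j: "j \<le> m"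
  shows "representing_map X (Suc m) (degen X m j x) = precomp \<infinity> (codegen j) (Suc m) (representing_map X m x)"
proof (rule representing_map_unique[OF X])
  let ?r = "representing_map X m x"
  interpret simplicial_set_upto \<infinity> X by (rule X)
  show "degen X m j x \<in> simplices X (Suc m)" using degen_in x j by simp
  show "simplicial_map (std_simplex (Suc m)) X (precomp \<infinity> (codegen j) (Suc m) ?r)"
    by (rule simplicial_map_precomp[OF codegen_mono_on(1) codegen_mono_on(2)[OF j] representing_map(1)[OF X x]])
  show "precomp \<infinity> (codegen j) (Suc m) ?r (Suc m) (top_simplex (Suc m)) = degen X m j x"
    using simplicial_map_degen[OF representing_map(1)[OF X x], of m j "top_simplex m"]
      representing_map(2)[OF X x] j top_simplex_in map_codegen_top[OF j]
    by (simp add: precomp_def)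
qed

lemma representing_map_cosk:
  assumes f: "f \<in> simplices (cosk n T) m" and \<theta>: "\<theta> \<in> simplices (std_simplex m) k"
  shows "representing_map (cosk n T) m f k \<theta> = precomp (enat n) ((!) \<theta>) k f"
proof -
  define R where "R k = restrict (\<lambda>\<theta>. precomp (enat n) ((!) \<theta>) k f) (simplices (std_simplex m) k)" for k
  have f': "simplicial_map_upto (enat n) (std_simplex m) T f" using f by (simp add: cosk_simps)
  interpret S: simplicial_set_upto \<infinity> "std_simplex m" by (rule simplicial_set_std)
  have th: "mono_on {..k} ((!) \<theta>)" "(!) \<theta> ` {..k} \<subseteq> {..m}" "length \<theta> = Suc k"
    if "\<theta> \<in> simplices (std_simplex m) k" for \<theta> k
    using that by (auto simp: std_simplex_simps mono_on_def sorted_iff_nth_mono subset_iff)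
  have "representing_map (cosk n T) m f = R"
  proof (rule representing_map_unique[OF simplicial_set_cosk f])
    show "simplicial_map (std_simplex m) (cosk n T) R"
      unfolding simplicial_map_upto_def
    proof (intro conjI allI impI; (elim conjE)?)
      fix k show "R k \<in> simplices (std_simplex m) k \<rightarrow>\<^sub>E simplices (cosk n T) k"
        using simplicial_map_precomp[OF th(1,2) f'] by (auto simp: R_def cosk_simps)
    next
      fix k j \<theta> assume j: "j \<le> Suc k" and t: "\<theta> \<in> simplices (std_simplex m) (Suc k)"
      have "R k (face (std_simplex m) (Suc k) j \<theta>) = precomp (enat n) ((!) (face (std_simplex m) (Suc k) j \<theta>)) k f"
        using S.face_in j t by (simp add: R_def)
      also have "\<dots> = precomp (enat n) ((!) \<theta> \<circ> coface j) k f"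
        using j th(3)[OF t] by (intro precomp_cong) (simp add: std_simplex_simps nth_del)
      finally show "R k (face (std_simplex m) (Suc k) j \<theta>) = face (cosk n T) (Suc k) j (R (Suc k) \<theta>)"
        using t by (simp add: R_def cosk_simps precomp_precomp[OF coface_mono_on])
    next
      fix k j \<theta> assume j: "j \<le> k" and t: "\<theta> \<in> simplices (std_simplex m) k"
      have "R (Suc k) (degen (std_simplex m) k j \<theta>) = precomp (enat n) ((!) (degen (std_simplex m) k j \<theta>)) (Suc k) f"
        using S.degen_in j t by (simp add: R_def)
      also have "\<dots> = precomp (enat n) ((!) \<theta> \<circ> codegen j) (Suc k) f"
        using j th(3)[OF t] by (intro precomp_cong) (simp add: std_simplex_simps nth_dup)
      finally show "R (Suc k) (degen (std_simplex m) k j \<theta>) = degen (cosk n T) k j (R k \<theta>)"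
        using t j by (simp add: R_def cosk_simps precomp_precomp[OF codegen_mono_on])
    qed simp
    have "R m (top_simplex m) = precomp (enat n) (\<lambda>v. v) m f"
      using top_simplex_in[of m] unfolding R_def
      by (auto simp: top_simplex_def simp del: upt_Suc intro!: precomp_cong)
    then show "R m (top_simplex m) = f" using precomp_id[OF f'] by simp
  qed
  then show ?thesis using \<theta> by (simp add: R_def)
qed

text \<open>The counit of the adjunction, and the transpose of a map \<open>tr n Y \<rightarrow> T\<close>.\<close>

definition cosk_counit :: "nat \<Rightarrow> 'a sset \<Rightarrow> nat \<Rightarrow> (nat \<Rightarrow> nat list \<Rightarrow> 'a) \<Rightarrow> 'a"
  where "cosk_counit n T k = restrict (\<lambda>f. f k (top_simplex k)) (simplices (tr n (cosk n T)) k)"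

definition cosk_transpose ::
    "nat \<Rightarrow> 'b sset \<Rightarrow> (nat \<Rightarrow> 'b \<Rightarrow> 'a) \<Rightarrow> nat \<Rightarrow> 'b \<Rightarrow> nat \<Rightarrow> nat list \<Rightarrow> 'a"
  where "cosk_transpose n Y h m =
    restrict (\<lambda>y. smap_comp (enat n) (std_simplex m) h (representing_map Y m y)) (simplices Y m)"

lemma simplicial_map_counit:
  "simplicial_map_upto (enat n) (tr n (cosk n T)) T (cosk_counit n T)"
proof -
  interpret S: simplicial_set_upto \<infinity> "cosk n T" by (rule simplicial_set_cosk)
  have simps: "cosk_counit n T k f = f k (top_simplex k)" if "k \<le> n" "f \<in> simplices (cosk n T) k" for k f
    using that by (simp add: cosk_counit_def tr_def)
  show ?thesis
    unfolding simplicial_map_tr unfolding simplicial_map_upto_def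
  proof (intro conjI allI impI; (elim conjE)?)
    fix k assume "enat k \<le> enat n"
    then show "cosk_counit n T k \<in> simplices (cosk n T) k \<rightarrow>\<^sub>E simplices T k"
      using top_simplex_in[of k]
      by (auto simp: cosk_counit_def tr_def cosk_simps intro: simplicial_map_in)
  next
    fix k assume "\<not> enat k \<le> enat n"
    then show "cosk_counit n T k = (\<lambda>_. undefined)" by (auto simp: cosk_counit_def tr_def)
  next
    fix k j f assume *: "enat (Suc k) \<le> enat n" "j \<le> Suc k" "f \<in> simplices (cosk n T) (Suc k)"
    have "face (cosk n T) (Suc k) j f k (top_simplex k) = f k (map (coface j) (top_simplex k))"
      using * top_simplex_in by (simp add: cosk_simps precomp_def)
    also have "\<dots> = face T (Suc k) j (f (Suc k) (top_simplex (Suc k)))"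
      using * simplicial_map_face[of "enat n" "std_simplex (Suc k)" T f k j "top_simplex (Suc k)"]
        top_simplex_in map_coface_top by (simp add: cosk_simps)
    finally show "cosk_counit n T k (face (cosk n T) (Suc k) j f)
        = face T (Suc k) j (cosk_counit n T (Suc k) f)"
      using * S.face_in by (simp add: simps)
  next
    fix k j f assume *: "enat (Suc k) \<le> enat n" "j \<le> k" "f \<in> simplices (cosk n T) k"
    have "degen (cosk n T) k j f (Suc k) (top_simplex (Suc k)) = f (Suc k) (map (codegen j) (top_simplex (Suc k)))"
      using * top_simplex_in by (simp add: cosk_simps precomp_def)
    also have "\<dots> = degen T k j (f k (top_simplex k))"
      using * simplicial_map_degen[of "enat n" "std_simplex k" T f k j "top_simplex k"]
        top_simplex_in map_codegen_top by (simp add: cosk_simps)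
    finally show "cosk_counit n T (Suc k) (degen (cosk n T) k j f)
        = degen T k j (cosk_counit n T k f)"
      using * S.degen_in by (simp add: simps)
  qed
qed

lemma smap_comp_precomp:
  assumes "mono_on {..m'} g" "g ` {..m'} \<subseteq> {..m}"
  shows "smap_comp N (std_simplex m') h (precomp \<infinity> g m' r) = precomp N g m' (smap_comp N (std_simplex m) h r)"
  using map_std_in[OF assms] by (auto simp: smap_comp_def precomp_def fun_eq_iff restrict_def)

lemma simplicial_map_transpose:
  assumes Y: "simplicial_set Y" and h: "simplicial_map_upto (enat n) (tr n Y) T h"
  shows "simplicial_map Y (cosk n T) (cosk_transpose n Y h)"
proof -
  interpret S: simplicial_set_upto \<infinity> Y by (rule Y)
  have h': "simplicial_map_upto (enat n) Y T h" using h by (simp add: simplicial_map_tr)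
  show ?thesis
    unfolding simplicial_map_upto_def
    using simplicial_map_comp[OF simplicial_set_std _ representing_map(1)[OF Y] h']
    by (auto simp: cosk_transpose_def cosk_simps representing_map_face[OF Y] representing_map_degen[OF Y]
        smap_comp_precomp[OF coface_mono_on] smap_comp_precomp[OF codegen_mono_on] S.face_in S.degen_in)
qed

lemma transpose_counit:
  assumes Y: "simplicial_set Y" and "y \<in> simplices Y k" "k \<le> n"
  shows "cosk_transpose n Y h k y k (top_simplex k) = h k y"
  using assms top_simplex_in representing_map(2)[OF Y] by (simp add: cosk_transpose_def smap_comp_def)

text \<open>
  The counit is a universal arrow from \<open>tr n\<close> to \<open>T\<close>, i.e. \<open>cosk n\<close> is right adjoint to \<open>tr n\<close>.
\<close>

theorem cosk_universal:
  assumes Y: "simplicial_set Y" and h: "simplicial_map_upto (enat n) (tr n Y) T h"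
  shows "\<exists>!g. simplicial_map Y (cosk n T) g \<and>
    (\<forall>k. \<forall>y\<in>simplices (tr n Y) k. cosk_counit n T k (g k y) = h k y)"
proof (rule ex1I)
  note t = simplicial_map_transpose[OF Y h]
  have cu: "cosk_counit n T k f = f k (top_simplex k)" if "k \<le> n" "f \<in> simplices (cosk n T) k" for k f
    using that by (simp add: cosk_counit_def simplices_tr)
  show "simplicial_map Y (cosk n T) (cosk_transpose n Y h) \<and>
    (\<forall>k. \<forall>y\<in>simplices (tr n Y) k. cosk_counit n T k (cosk_transpose n Y h k y) = h k y)"
    using t transpose_counit[OF Y] simplicial_map_in[OF t]
    by (auto simp: simplices_tr cu)
  fix g
  assume g: "simplicial_map Y (cosk n T) g \<and>
    (\<forall>k. \<forall>y\<in>simplices (tr n Y) k. cosk_counit n T k (g k y) = h k y)"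
  then have gm: "simplicial_map Y (cosk n T) g" by simp
  have gc: "g k y k (top_simplex k) = h k y" if "k \<le> n" "y \<in> simplices Y k" for k y
    using g that cu[of k "g k y"] simplicial_map_in[OF gm] by (auto simp: simplices_tr)
  show "g = cosk_transpose n Y h"
  proof (rule simplicial_map_eqI[OF gm t])
    fix m y assume y: "y \<in> simplices Y m"
    let ?r = "representing_map Y m y"
    note r = representing_map[OF Y y]
    have gy: "g m y \<in> simplices (cosk n T) m" using simplicial_map_in[OF gm] y by simp
    have gr: "representing_map (cosk n T) m (g m y) = smap_comp \<infinity> (std_simplex m) g ?r"
      by (rule representing_map_unique[OF simplicial_set_cosk gy
          simplicial_map_comp[OF simplicial_set_std _ r(1) gm]])
        (use r top_simplex_in in \<open>auto simp: smap_comp_def\<close>)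
    have "g m y = smap_comp (enat n) (std_simplex m) h ?r"
    proof (rule simplicial_map_eqI)
      show "simplicial_map_upto (enat n) (std_simplex m) T (g m y)" using gy by (simp add: cosk_simps)
      show "simplicial_map_upto (enat n) (std_simplex m) T (smap_comp (enat n) (std_simplex m) h ?r)"
        by (rule simplicial_map_comp[OF simplicial_set_std _ r(1)]) (use h in \<open>auto simp: simplicial_map_tr\<close>)
      fix k \<theta> assume k: "enat k \<le> enat n" and \<theta>: "\<theta> \<in> simplices (std_simplex m) k"
      have "g m y k \<theta> = precomp (enat n) ((!) \<theta>) k (g m y) k (top_simplex k)"
      proof -
        have "map ((!) \<theta>) (top_simplex k) = \<theta>"
          using \<theta> map_nth[of \<theta>] by (simp add: top_simplex_def std_simplex_simps)
        then show ?thesis using k top_simplex_in by (simp add: precomp_def)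
      qed
      also have "\<dots> = g k (?r k \<theta>) k (top_simplex k)"
        using representing_map_cosk[OF gy \<theta>] gr \<theta> by (simp add: smap_comp_def)
      also have "\<dots> = h k (?r k \<theta>)"
        using gc k simplicial_map_in[OF r(1) _ \<theta>] by simp
      finally show "g m y k \<theta> = smap_comp (enat n) (std_simplex m) h ?r k \<theta>"
        using k \<theta> by (simp add: smap_comp_def)
    qed
    then show "g m y = cosk_transpose n Y h m y" using y by (simp add: cosk_transpose_def)
  qed
qed

text \<open>\<open>cosk_unit\<close> is the unit of this adjunction.\<close>

theorem cosk_unit_is_unit:
  assumes X: "simplicial_set X"
  shows "simplicial_map X (Cosk n X) (cosk_unit n X)"
    and "x \<in> simplices (tr n X) k \<Longrightarrow> cosk_counit n (tr n X) k (cosk_unit n X k x) = x"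
proof -
  define h where "h k = restrict (\<lambda>x. x) (simplices (tr n X) k)" for k
  interpret simplicial_set_upto \<infinity> X by (rule X)
  have h: "simplicial_map_upto (enat n) (tr n X) (tr n X) h"
    unfolding simplicial_map_upto_def using face_in degen_in by (auto simp: h_def tr_def)
  have "cosk_unit n X = cosk_transpose n X h"
  proof (intro ext)
    fix m x k \<theta>
    show "cosk_unit n X m x k \<theta> = cosk_transpose n X h m x k \<theta>"
      using representing_map(1)[OF X, of x m]
      by (auto simp: cosk_unit_def cosk_transpose_def tr_map_def smap_comp_def h_def tr_def restrict_def
          simplicial_map_upto_def PiE_def extensional_def Pi_def)
  qed
  moreover note simplicial_map_transpose[OF X h] transpose_counit[OF X, of x k n h]
  moreover note simplicial_map_in[OF simplicial_map_transpose[OF X h], of k x]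
  ultimately show "simplicial_map X (Cosk n X) (cosk_unit n X)"
    and "x \<in> simplices (tr n X) k \<Longrightarrow> cosk_counit n (tr n X) k (cosk_unit n X k x) = x"
    by (auto simp: h_def cosk_counit_def tr_def split: if_splits)
qed

end

theory Submission
  imports Defs
begin

text \<open>
  A matrix in \<open>N\<^sub>n\<close> is a compact code for the family of its faces of dimension at most 2. The edge
  on the vertices \<open>i \<le> j\<close> is a morphism \<open>f\<^sub>i\<^sub>j\<close> from \<open>x\<^sub>j\<close> to \<open>x\<^sub>i\<close>, and the triangle on \<open>i \<le> j \<le> k\<close>
  carries an element \<open>a\<^sub>i\<^sub>j\<^sub>k\<close> of \<open>A(x\<^sub>j)\<close> with \<open>f\<^sub>i\<^sub>k = f\<^sub>i\<^sub>j \<partial>(a\<^sub>i\<^sub>j\<^sub>k) f\<^sub>j\<^sub>k\<close>. Four vertices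
  \<open>i \<le> j \<le> k \<le> l\<close> span a 3-simplex, and this amounts to the existence of an element \<open>b\<close> of \<open>A(x\<^sub>j)\<close>
  such that \<open>a\<^sub>i\<^sub>j\<^sub>l = a\<^sub>i\<^sub>j\<^sub>k b\<close> and \<open>a\<^sub>i\<^sub>k\<^sub>l = b\<^sup>f a\<^sub>j\<^sub>k\<^sub>l\<close>, the exponent \<open>f\<close> being \<open>f\<^sub>j\<^sub>k\<close>. By left
  cancellation the triangles determine \<open>b\<close>.

  These conditions characterize the families that come from matrices. That a matrix satisfies them
  is a computation with the Peiffer relation (\<open>coherent_nerve\<close>). Conversely, the elements \<open>b\<close> of the
  quadruples \<open>i - 1, i, k - 1, k\<close> are the entries of a matrix with the given faces
  (\<open>realize_coherent\<close>), and this matrix is unique (\<open>label_inj\<close>).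

  The description settles both halves of the claim. Face and degeneracy maps become reindexings of
  families along cofaces and codegeneracies, whence the simplicial identities. And since every
  condition concerns at most four vertices, a family is coherent as soon as it is so on all
  3-dimensional faces (\<open>coherent_local\<close>): the simplices over \<open>\<Delta>[n]\<close> are the compatible families of
  3-simplices over its 3-dimensional faces, which is what 3-coskeletality asks for. The passage from
  this local characterization to the unit map of the coskeleton works for any simplicial set whose
  simplices are separated by labels on faces of a fixed dimension
  (\<open>coskeletal_if_local_fillers\<close>).
\<close>

section \<open>Simplicial sets determined by labels on faces\<close>

text \<open>
  A monotone map that misses a value factors through the coface omitting it, and one that takes a
  value twice in succession factors through a codegeneracy; only identities do neither. The factoring
  never leaves the dimensions up to the larger of \<open>k\<close> and \<open>l\<close>. This bound \<open>N\<close> is what lets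
  the induction run on maps that are defined up to a finite degree only.
\<close>

lemma std_simplex_induct [consumes 1, case_names top coface degen]:
  assumes "\<rho> \<in> simplices (std_simplex l) k"
    and top: "\<And>k. P k k (top_simplex k)"
    and coface: "\<And>k l j \<rho>. \<rho> \<in> simplices (std_simplex l) k \<Longrightarrow> j \<le> Suc l \<Longrightarrow> l < N \<Longrightarrow> P l k \<rho>
      \<Longrightarrow> P (Suc l) k (map (coface j) \<rho>)"
    and degen: "\<And>k l j \<rho>. \<rho> \<in> simplices (std_simplex l) k \<Longrightarrow> j \<le> k \<Longrightarrow> k < N \<Longrightarrow> P l k \<rho>
      \<Longrightarrow> P l (Suc k) (degen (std_simplex l) k j \<rho>)"
    and "l \<le> N" "k \<le> N"
  shows "P l k \<rho>"
  using assms(1,5,6)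
proof (induction "l + k" arbitrary: l k \<rho> rule: less_induct)
  case less
  have \<rho>: "length \<rho> = Suc k" "sorted \<rho>" "set \<rho> \<subseteq> {..l}"
    using less.prems by (auto simp: std_simplex_simps)
  consider (skip) j where "j \<le> l" "j \<notin> set \<rho>" | (onto) "set \<rho> = {..l}" using \<rho>(3) by auto
  then show ?case
  proof cases
    case skip
    have "hd \<rho> \<in> set \<rho>" using \<rho>(1) by (cases \<rho>) auto
    then have "hd \<rho> \<le> l" "hd \<rho> \<noteq> j" using \<rho>(3) skip by auto
    then obtain l' where l: "l = Suc l'" using skip by (cases l) auto
    \<comment> \<open>A left inverse of the coface on the values other than \<open>j\<close>.\<close>
    let ?c = "\<lambda>v. if v < j then v else v - 1"
    have c: "coface j (?c v) = v" if "v \<in> set \<rho>" for v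
      using that skip by (cases "v = j") (auto simp: coface_def)
    have eq: "map (coface j) (map ?c \<rho>) = \<rho>" by (simp add: map_idI c)
    have "mono ?c" by (auto simp: mono_def)
    moreover have "set (map ?c \<rho>) \<subseteq> {..l'}" using \<rho>(3) skip l by fastforce
    ultimately have in': "map ?c \<rho> \<in> simplices (std_simplex l') k"
      using \<rho>(1,2) by (simp add: std_simplex_simps sorted_iff_nth_mono mono_def)
    have "P (Suc l') k (map (coface j) (map ?c \<rho>))"
      using less.hyps[OF _ in'] less.prems skip l by (intro coface[OF in']) auto
    then show ?thesis using eq l by simp
  next
    case onto
    show ?thesis
    proof (cases "distinct \<rho>")
      case True
      then have "\<rho> = [0..<Suc l]"
        using \<rho>(2) onto by (intro sorted_distinct_set_unique) (auto simp del: upt_Suc)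
      then show ?thesis using top[of l] \<rho>(1) by (simp add: top_simplex_def del: upt_Suc)
    next
      case False
      then have "\<exists>j<k. \<rho> ! j = \<rho> ! Suc j"
        using \<rho>(1,2) by (metis sorted_wrt_iff_nth_Suc_transp strict_sorted_iff sorted_iff_nth_Suc
          Suc_less_eq order_neq_le_trans transp_on_less)
      then obtain j where j: "j < k" "\<rho> ! j = \<rho> ! Suc j" by blast
      then obtain k' where k: "k = Suc k'" by (cases k) auto
      interpret simplicial_set_upto \<infinity> "std_simplex l" by (rule simplicial_set_std)
      let ?r = "face (std_simplex l) (Suc k') j \<rho>"
      have in': "?r \<in> simplices (std_simplex l) k'" using face_in[of k' j \<rho>] less.prems j k by simp
      have len: "length ?r = Suc k'" using in' by (simp add: std_simplex_simps)
      have eq: "degen (std_simplex l) k' j ?r = \<rho>"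
      proof (rule nth_equalityI)
        show l1: "length (degen (std_simplex l) k' j ?r) = length \<rho>"
          using len \<rho>(1) j k by (simp add: std_simplex_simps(3))
        fix i assume "i < length (degen (std_simplex l) k' j ?r)"
        then have i: "i < Suc (Suc k')" using l1 \<rho>(1) k by simp
        have "degen (std_simplex l) k' j ?r ! i = ?r ! codegen j i"
          using len i j k by (simp add: std_simplex_simps(3) nth_dup)
        also have "\<dots> = \<rho> ! coface j (codegen j i)"
          unfolding std_simplex_simps(2) using \<rho>(1) i j k
          by (intro nth_del) (auto simp: codegen_def)
        also have "\<dots> = \<rho> ! i" using j by (cases "i = j \<or> i = Suc j") (auto simp: coface_def codegen_def)
        finally show "degen (std_simplex l) k' j ?r ! i = \<rho> ! i" .
      qed
      have "P l (Suc k') (degen (std_simplex l) k' j ?r)"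
        using less.hyps[OF _ in'] less.prems j k by (intro degen[OF in']) auto
      then show ?thesis using eq k by simp
    qed
  qed
qed

text \<open>
  Composition of monotone maps: precomposing the list \<open>\<theta>\<close> with \<open>\<rho>\<close> is \<open>map ((!) \<theta>) \<rho>\<close>.
\<close>

lemma map_nth_std_in:
  assumes "\<theta> \<in> simplices (std_simplex m) l" "\<rho> \<in> simplices (std_simplex l) k"
  shows "map ((!) \<theta>) \<rho> \<in> simplices (std_simplex m) k"
  by (rule map_std_in[OF _ _ assms(2)])
    (use assms(1) in \<open>auto simp: std_simplex_simps mono_on_def sorted_iff_nth_mono subset_iff\<close>)

lemma simplicial_map_into_tr:
  "simplicial_map_upto (enat n) X (tr n Y) f \<longleftrightarrow> simplicial_map_upto (enat n) X Y f"
  using simplicial_map_tr(1)[of n X Y f] simplicial_map_tr(2)[of n X "tr n Y" f] by simp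

lemma simplicial_iso_if_bij:
  assumes X: "simplicial_set X" and f: "simplicial_map X Y f"
    and bij: "\<And>k. bij_betw (f k) (simplices X k) (simplices Y k)"
  shows "simplicial_iso X Y f"
proof -
  interpret simplicial_set_upto \<infinity> X by (rule X)
  define g where "g k = restrict (inv_into (simplices X k) (f k)) (simplices Y k)" for k
  have gf: "g k (f k x) = x" if "x \<in> simplices X k" for k x
    using that bij[of k] bij_betwE[OF bij[of k]]
    by (auto simp: g_def bij_betw_inv_into_left[OF bij])
  have surj: "\<exists>x\<in>simplices X k. y = f k x" if "y \<in> simplices Y k" for k y
    using that bij[of k] by (auto simp: bij_betw_def)
  have "simplicial_map Y X g"
    unfolding simplicial_map_upto_def
  proof (intro conjI allI impI; (elim conjE)?)
    fix k show "g k \<in> simplices Y k \<rightarrow>\<^sub>E simplices X k"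
      using surj[of _ k] gf[of _ k] by (fastforce simp: g_def)
  next
    fix k j y assume j: "j \<le> Suc k" and "y \<in> simplices Y (Suc k)"
    then obtain x where x: "x \<in> simplices X (Suc k)" "y = f (Suc k) x" using surj by blast
    have "face Y (Suc k) j y = f k (face X (Suc k) j x)"
      using simplicial_map_face[OF f _ j x(1)] x by simp
    then show "g k (face Y (Suc k) j y) = face X (Suc k) j (g (Suc k) y)"
      using gf face_in[of k j x] x j by simp
  next
    fix k j y assume j: "j \<le> k" and "y \<in> simplices Y k"
    then obtain x where x: "x \<in> simplices X k" "y = f k x" using surj by blast
    have "degen Y k j y = f (Suc k) (degen X k j x)"
      using simplicial_map_degen[OF f _ j x(1)] x by simp
    then show "g (Suc k) (degen Y k j y) = degen X k j (g k y)"
      using gf degen_in[of k j x] x j by simp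
  qed simp
  moreover have "f k (g k y) = y" if "y \<in> simplices Y k" for k y
    using surj[OF that] gf by auto
  ultimately show ?thesis using f gf unfolding simplicial_iso_def by blast
qed

text \<open>
  A labelling records what is visible of an \<open>n\<close>-simplex on its \<open>r\<close>-dimensional faces, degenerate
  ones included, in such a way that a simplicial operator acts on labels by nothing but reindexing.
  If the labels separate simplices, then the simplicial set is a subobject of one in which operators
  are reindexings, and its simplicial identities come for free.
\<close>

locale face_labelling =
  fixes X :: "'a sset" and r :: nat and lab :: "nat \<Rightarrow> 'a \<Rightarrow> nat list \<Rightarrow> 'b"
  assumes lab_face_in: "j \<le> Suc n \<Longrightarrow> x \<in> simplices X (Suc n) \<Longrightarrow> face X (Suc n) j x \<in> simplices X n"
    and lab_degen_in: "j \<le> n \<Longrightarrow> x \<in> simplices X n \<Longrightarrow> degen X n j x \<in> simplices X (Suc n)"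
    and lab_face: "\<lbrakk>j \<le> Suc n; x \<in> simplices X (Suc n); \<rho> \<in> simplices (std_simplex n) r\<rbrakk>
      \<Longrightarrow> lab n (face X (Suc n) j x) \<rho> = lab (Suc n) x (map (coface j) \<rho>)"
    and lab_degen: "\<lbrakk>j \<le> n; x \<in> simplices X n; \<rho> \<in> simplices (std_simplex (Suc n)) r\<rbrakk>
      \<Longrightarrow> lab (Suc n) (degen X n j x) \<rho> = lab n x (map (codegen j) \<rho>)"
    and lab_inj: "\<lbrakk>x \<in> simplices X n; y \<in> simplices X n;
        \<And>\<rho>. \<rho> \<in> simplices (std_simplex n) r \<Longrightarrow> lab n x \<rho> = lab n y \<rho>\<rbrakk> \<Longrightarrow> x = y"
begin

lemma simplicial_set_labelled: "simplicial_set X"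
proof
  note c = map_std_in[OF coface_mono_on] map_std_in[OF codegen_mono_on]
  note l = lab_face lab_degen lab_face_in lab_degen_in c
  show "face X (Suc n) i (face X (Suc (Suc n)) j x) = face X (Suc n) (j - 1) (face X (Suc (Suc n)) i x)"
    if "i < j" "j \<le> Suc (Suc n)" "x \<in> simplices X (Suc (Suc n))" for n i j x
    by (rule lab_inj[where n = "n"]) (use that in \<open>auto simp: l coface_codegen o_def\<close>)
  show "degen X (Suc n) i (degen X n j x) = degen X (Suc n) (Suc j) (degen X n i x)"
    if "i \<le> j" "j \<le> n" "x \<in> simplices X n" for n i j x
    by (rule lab_inj[where n = "Suc (Suc n)"]) (use that in \<open>auto simp: l coface_codegen o_def\<close>)
  show "face X (Suc (Suc n)) i (degen X (Suc n) j x) = degen X n (j - 1) (face X (Suc n) i x)"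
    if "i < j" "j \<le> Suc n" "x \<in> simplices X (Suc n)" for n i j x
    by (rule lab_inj[where n = "Suc n"]) (use that in \<open>auto simp: l coface_codegen o_def\<close>)
  show "face X (Suc n) i (degen X n j x) = x"
    if "j \<le> n" "i = j \<or> i = Suc j" "x \<in> simplices X n" for n i j x
    by (rule lab_inj[where n = "n"]) (use that in \<open>auto simp: l coface_codegen o_def\<close>)
  show "face X (Suc (Suc n)) i (degen X (Suc n) j x) = degen X n j (face X (Suc n) (i - 1) x)"
    if "Suc j < i" "i \<le> Suc (Suc n)" "x \<in> simplices X (Suc n)" for n i j x
    by (rule lab_inj[where n = "Suc n"]) (use that in \<open>auto simp: l coface_codegen o_def\<close>)
qed (use lab_face_in lab_degen_in in auto)

text \<open>
  A simplicial map respects the labels on the restrictions of \<open>\<theta>\<close> along every monotone \<open>\<rho>\<close>, also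
  when it is defined up to degree \<open>M\<close> only: cofaces and codegeneracies generate, and the labels
  turn each of them into a reindexing.
\<close>

lemma lab_simplicial_map:
  assumes g: "simplicial_map_upto M (std_simplex m) X g"
    and \<theta>: "\<theta> \<in> simplices (std_simplex m) l" "enat l \<le> M"
    and \<rho>: "\<rho> \<in> simplices (std_simplex l) k" "enat k \<le> M"
    and \<sigma>: "\<sigma> \<in> simplices (std_simplex k) r"
  shows "lab k (g k (map ((!) \<theta>) \<rho>)) \<sigma> = lab l (g l \<theta>) (map ((!) \<rho>) \<sigma>)"
proof -
  interpret S: simplicial_set_upto \<infinity> "std_simplex m" by (rule simplicial_set_std)
  have M: "enat i \<le> M" if "i \<le> max k l" for i
  proof -
    have "enat (max k l) \<le> M" using \<theta>(2) \<rho>(2) by (simp add: max_def)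
    then show ?thesis using that by (meson enat_ord_simps(1) order_trans)
  qed
  have len: "length \<tau> = Suc q" "\<tau>' \<in> simplices (std_simplex q) p \<Longrightarrow> v \<in> set \<tau>' \<Longrightarrow> v < length \<tau>"
    if "\<tau> \<in> simplices (std_simplex p') q" for \<tau> \<tau>' p p' q v
    using that by (auto simp: std_simplex_simps)
  let ?P = "\<lambda>l k \<rho>. \<forall>\<theta>\<in>simplices (std_simplex m) l. map ((!) \<theta>) \<rho> \<in> simplices (std_simplex m) k \<and>
      (\<forall>\<sigma>\<in>simplices (std_simplex k) r. lab k (g k (map ((!) \<theta>) \<rho>)) \<sigma> = lab l (g l \<theta>) (map ((!) \<rho>) \<sigma>))"
  have "?P l k \<rho>"
    using \<rho>(1)
  proof (induction \<rho> rule: std_simplex_induct[where N = "max k l"])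
    case (top k)
    have "map ((!) \<theta>) (top_simplex k) = \<theta>" if "length \<theta> = Suc k" for \<theta> :: "nat list"
      using map_nth[of \<theta>] that by (simp add: top_simplex_def)
    moreover have "map ((!) (top_simplex k)) \<sigma> = \<sigma>" if "\<sigma> \<in> simplices (std_simplex k) r" for \<sigma>
      using that by (auto simp: std_simplex_simps top_simplex_def simp del: upt_Suc intro!: map_idI)
    ultimately show ?case by (simp add: len)
  next
    case (coface q p j \<rho>)
    show ?case
    proof (intro conjI ballI)
      fix \<theta> assume \<theta>: "\<theta> \<in> simplices (std_simplex m) (Suc p)"
      have IH: "map ((!) \<theta>) \<rho> \<in> simplices (std_simplex m) q"
        "\<sigma> \<in> simplices (std_simplex q) r \<Longrightarrow> lab q (g q (map ((!) \<theta>) \<rho>)) \<sigma> = lab p (g p \<theta>) (map ((!) \<rho>) \<sigma>)"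
        if "\<theta> \<in> simplices (std_simplex m) p" for \<theta> \<sigma>
        using coface that by auto
      let ?\<theta>' = "face (std_simplex m) (Suc p) j \<theta>"
      have \<theta>': "?\<theta>' \<in> simplices (std_simplex m) p" using S.face_in \<theta> coface by simp
      have eq: "map ((!) \<theta>) (map (coface j) \<rho>) = map ((!) ?\<theta>') \<rho>"
        using len(1)[OF \<theta>] len(2)[OF \<theta>' coface(1)] len(1)[OF \<theta>'] coface(2)
        by (auto simp: std_simplex_simps(2) nth_del)
      have gin: "g (Suc p) \<theta> \<in> simplices X (Suc p)"
        using simplicial_map_in[OF g _ \<theta>] M coface by simp
      have gf: "g p ?\<theta>' = face X (Suc p) j (g (Suc p) \<theta>)"
        using simplicial_map_face[OF g _ _ \<theta>] M coface by simp
      show "map ((!) \<theta>) (map (coface j) \<rho>) \<in> simplices (std_simplex m) q"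
        unfolding eq using IH(1)[OF \<theta>'] .
      fix \<sigma> assume \<sigma>: "\<sigma> \<in> simplices (std_simplex q) r"
      have s: "map ((!) \<rho>) \<sigma> \<in> simplices (std_simplex p) r"
        by (rule map_nth_std_in[OF coface(1) \<sigma>])
      have eq': "map ((!) (map (coface j) \<rho>)) \<sigma> = map (coface j) (map ((!) \<rho>) \<sigma>)"
        using len(2)[OF coface(1) \<sigma>] by simp
      show "lab q (g q (map ((!) \<theta>) (map (coface j) \<rho>))) \<sigma> =
          lab (Suc p) (g (Suc p) \<theta>) (map ((!) (map (coface j) \<rho>)) \<sigma>)"
        unfolding eq eq' using IH(2)[OF \<theta>' \<sigma>] lab_face[OF coface(2) gin s] gf by (simp del: map_map)
    qed
  next
    case (degen q p j \<rho>)
    show ?case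
    proof (intro conjI ballI)
      fix \<theta> assume \<theta>: "\<theta> \<in> simplices (std_simplex m) p"
      have IH: "map ((!) \<theta>) \<rho> \<in> simplices (std_simplex m) q"
        "\<And>\<sigma>. \<sigma> \<in> simplices (std_simplex q) r \<Longrightarrow> lab q (g q (map ((!) \<theta>) \<rho>)) \<sigma> = lab p (g p \<theta>) (map ((!) \<rho>) \<sigma>)"
        using degen.IH \<theta> by auto
      have eq: "map ((!) \<theta>) (degen (std_simplex p) q j \<rho>) = degen (std_simplex m) q j (map ((!) \<theta>) \<rho>)"
        by (simp add: std_simplex_simps(3) take_map drop_map)
      have gin: "g q (map ((!) \<theta>) \<rho>) \<in> simplices X q"
        using simplicial_map_in[OF g _ IH(1)] M degen by simp
      have gd: "g (Suc q) (degen (std_simplex m) q j (map ((!) \<theta>) \<rho>)) = degen X q j (g q (map ((!) \<theta>) \<rho>))"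
        using simplicial_map_degen[OF g _ _ IH(1)] M degen by simp
      show "map ((!) \<theta>) (degen (std_simplex p) q j \<rho>) \<in> simplices (std_simplex m) (Suc q)"
        unfolding eq using S.degen_in[of q j] IH(1) degen(2) by simp
      fix \<sigma> assume \<sigma>: "\<sigma> \<in> simplices (std_simplex (Suc q)) r"
      have s: "map (codegen j) \<sigma> \<in> simplices (std_simplex q) r"
        using map_std_in[OF codegen_mono_on] \<sigma> degen by blast
      have eq': "map ((!) (degen (std_simplex p) q j \<rho>)) \<sigma> = map ((!) \<rho>) (map (codegen j) \<sigma>)"
        using \<sigma> len(1)[OF degen(1)] degen(2)
        by (auto simp: std_simplex_simps nth_dup less_Suc_eq_le)
      show "lab (Suc q) (g (Suc q) (map ((!) \<theta>) (degen (std_simplex p) q j \<rho>))) \<sigma> =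
          lab p (g p \<theta>) (map ((!) (degen (std_simplex p) q j \<rho>)) \<sigma>)"
        unfolding eq eq' using lab_degen[OF degen(2) gin \<sigma>] IH(2)[OF s] gd
        by (simp del: map_map)
    qed
  qed auto
  then show ?thesis using \<theta>(1) \<sigma> by simp
qed

text \<open>
  A simplex of \<open>Cosk N X\<close> is a compatible choice of an \<open>N\<close>-simplex for each \<open>N\<close>-dimensional face
  of \<open>\<Delta>[n]\<close>. Since \<open>r \<le> N\<close>, such a choice determines a single function \<open>F\<close> on the
  \<open>r\<close>-dimensional faces, so filling it means realizing \<open>F\<close> by labels; uniqueness is the separation
  of simplices by labels.
\<close>

lemma coskeletal_if_local_fillers:
  assumes "r \<le> N"
    and fill: "\<And>n F. (\<And>\<theta>. \<theta> \<in> simplices (std_simplex n) N \<Longrightarrow> \<exists>y\<in>simplices X N.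
        \<forall>\<rho>\<in>simplices (std_simplex N) r. lab N y \<rho> = F (map ((!) \<theta>) \<rho>))
      \<Longrightarrow> \<exists>x\<in>simplices X n. \<forall>\<rho>\<in>simplices (std_simplex n) r. lab n x \<rho> = F \<rho>"
  shows "coskeletal N X"
proof -
  note S = simplicial_set_labelled
  have nth_top: "map ((!) (top_simplex k)) \<rho> = \<rho>" if "\<rho> \<in> simplices (std_simplex k) l" for k l \<rho>
    using that by (auto simp: std_simplex_simps top_simplex_def simp del: upt_Suc intro!: map_idI)
  have top_nth: "map ((!) \<rho>) (top_simplex l) = \<rho>" if "\<rho> \<in> simplices (std_simplex k) l" for k l \<rho>
    using that map_nth[of \<rho>] by (simp add: top_simplex_def std_simplex_simps)
  have lab_rep: "lab k (representing_map X m x k \<theta>) \<sigma> = lab m x (map ((!) \<theta>) \<sigma>)"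
    if "x \<in> simplices X m" "\<theta> \<in> simplices (std_simplex m) k" "\<sigma> \<in> simplices (std_simplex k) r" for m x k \<theta> \<sigma>
    using lab_simplicial_map[OF representing_map(1)[OF S that(1)] top_simplex_in _ that(2) _ that(3)]
      nth_top[OF that(2)] representing_map(2)[OF S that(1)] by simp
  note u = cosk_unit_is_unit(1)[OF S, of N]
  have u_eq: "cosk_unit N X m x = tr_map N (representing_map X m x)" if "x \<in> simplices X m" for m x
    using that by (simp add: cosk_unit_def)
  have "inj_on (cosk_unit N X m) (simplices X m)" for m
  proof (rule inj_onI)
    fix x y assume xy: "x \<in> simplices X m" "y \<in> simplices X m" and eq: "cosk_unit N X m x = cosk_unit N X m y"
    show "x = y"
    proof (rule lab_inj[OF xy])
      fix \<rho> assume \<rho>: "\<rho> \<in> simplices (std_simplex m) r"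
      have "tr_map N (representing_map X m x) r \<rho> = tr_map N (representing_map X m y) r \<rho>"
        using eq u_eq xy by simp
      then show "lab m x \<rho> = lab m y \<rho>"
        using lab_rep[OF xy(1) \<rho> top_simplex_in] lab_rep[OF xy(2) \<rho> top_simplex_in] assms(1)
        by (simp add: top_nth[OF \<rho>] tr_map_def)
    qed
  qed
  moreover have "cosk_unit N X m ` simplices X m \<subseteq> simplices (Cosk N X) m" for m
    using simplicial_map_in[OF u] by auto
  moreover have "simplices (Cosk N X) m \<subseteq> cosk_unit N X m ` simplices X m" for m
  proof
    fix g assume "g \<in> simplices (Cosk N X) m"
    then have g: "simplicial_map_upto (enat N) (std_simplex m) X g"
      by (simp add: cosk_simps simplicial_map_into_tr)
    define F where "F \<rho> = lab r (g r \<rho>) (top_simplex r)" for \<rho>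
    have lab_g: "lab k (g k \<theta>) \<sigma> = F (map ((!) \<theta>) \<sigma>)"
      if "k \<le> N" "\<theta> \<in> simplices (std_simplex m) k" "\<sigma> \<in> simplices (std_simplex k) r" for k \<theta> \<sigma>
      using lab_simplicial_map[OF g that(2) _ that(3) _ top_simplex_in] that(1) assms(1)
      by (simp add: F_def top_nth[OF that(3)])
    obtain x where x: "x \<in> simplices X m" "\<And>\<rho>. \<rho> \<in> simplices (std_simplex m) r \<Longrightarrow> lab m x \<rho> = F \<rho>"
    proof -
      have "\<exists>y\<in>simplices X N. \<forall>\<rho>\<in>simplices (std_simplex N) r. lab N y \<rho> = F (map ((!) \<theta>) \<rho>)"
        if "\<theta> \<in> simplices (std_simplex m) N" for \<theta>
        using simplicial_map_in[OF g _ that] lab_g[OF _ that] by auto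
      from fill[OF this] show ?thesis using that by blast
    qed
    have "tr_map N (representing_map X m x) = g"
    proof (rule simplicial_map_eqI[OF _ g])
      show "simplicial_map_upto (enat N) (std_simplex m) X (tr_map N (representing_map X m x))"
        using simplicial_map_tr_map[OF representing_map(1)[OF S x(1)], of N]
        by (simp add: simplicial_map_tr simplicial_map_into_tr)
      fix k \<theta> assume k: "enat k \<le> enat N" and \<theta>: "\<theta> \<in> simplices (std_simplex m) k"
      have "representing_map X m x k \<theta> = g k \<theta>"
      proof (rule lab_inj)
        show "representing_map X m x k \<theta> \<in> simplices X k"
          using simplicial_map_in[OF representing_map(1)[OF S x(1)] _ \<theta>] by simp
        show "g k \<theta> \<in> simplices X k" using simplicial_map_in[OF g k \<theta>] .
        fix \<sigma> assume \<sigma>: "\<sigma> \<in> simplices (std_simplex k) r"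
        have "map ((!) \<theta>) \<sigma> \<in> simplices (std_simplex m) r"
          by (rule map_nth_std_in[OF \<theta> \<sigma>])
        then show "lab k (representing_map X m x k \<theta>) \<sigma> = lab k (g k \<theta>) \<sigma>"
          using lab_rep[OF x(1) \<theta> \<sigma>] lab_g[OF _ \<theta> \<sigma>] x(2) k by simp
      qed
      then show "tr_map N (representing_map X m x) k \<theta> = g k \<theta>" using k by (simp add: tr_map_def)
    qed
    then show "g \<in> cosk_unit N X m ` simplices X m" using u_eq[OF x(1)] x(1) by force
  qed
  ultimately have "bij_betw (cosk_unit N X m) (simplices X m) (simplices (Cosk N X) m)" for m
    unfolding bij_betw_def by blast
  then show ?thesis using simplicial_iso_if_bij[OF S u] S by (simp add: coskeletal_def)
qed

end

section \<open>Arithmetic of crossed monoids\<close>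

lemma ordered_prod_Nil [simp]: "ordered_prod G [] = \<one>\<^bsub>G\<^esub>"
  by (simp add: ordered_prod_def)

lemma ordered_prod_closed:
  assumes "monoid G"
  shows "set as \<subseteq> carrier G \<Longrightarrow> ordered_prod G as \<in> carrier G"
proof -
  interpret monoid G by fact
  show "set as \<subseteq> carrier G \<Longrightarrow> ordered_prod G as \<in> carrier G"
    by (induction as) (auto simp: ordered_prod_def)
qed

lemma ordered_prod_append:
  assumes "monoid G" "set as \<subseteq> carrier G" "set bs \<subseteq> carrier G"
  shows "ordered_prod G (as @ bs) = ordered_prod G as \<otimes>\<^bsub>G\<^esub> ordered_prod G bs"
proof -
  interpret monoid G by fact
  show ?thesis
    using assms(2) ordered_prod_closed[OF assms(1,3)]
  proof (induction as)
    case (Cons a as)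
    then show ?case using ordered_prod_closed[OF assms(1), of as]
      by (simp add: ordered_prod_def m_assoc)
  qed (simp add: ordered_prod_def)
qed

context crossed_monoid
begin

abbreviation comp (infixr "\<diamondop>" 75) where "\<alpha> \<diamondop> \<beta> \<equiv> cat_comp C \<alpha> \<beta>"

lemma hom_obj: "\<alpha> \<in> hom_set C s t \<Longrightarrow> s \<in> Obj C" "\<alpha> \<in> hom_set C s t \<Longrightarrow> t \<in> Obj C"
  using src_in tgt_in by (auto simp: hom_set_def)

lemma mult_closed: "\<lbrakk>t \<in> Obj C; a \<in> carrier (A t); b \<in> carrier (A t)\<rbrakk> \<Longrightarrow> a \<otimes>\<^bsub>A t\<^esub> b \<in> carrier (A t)"
  using monoid.m_closed[OF monoid_A] .

lemma mult_assoc: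
  "\<lbrakk>t \<in> Obj C; a \<in> carrier (A t); b \<in> carrier (A t); c \<in> carrier (A t)\<rbrakk>
    \<Longrightarrow> (a \<otimes>\<^bsub>A t\<^esub> b) \<otimes>\<^bsub>A t\<^esub> c = a \<otimes>\<^bsub>A t\<^esub> (b \<otimes>\<^bsub>A t\<^esub> c)"
  using monoid.m_assoc[OF monoid_A] .

lemma one_closed: "t \<in> Obj C \<Longrightarrow> \<one>\<^bsub>A t\<^esub> \<in> carrier (A t)"
  using monoid.one_closed[OF monoid_A] .

lemma mult_one: "t \<in> Obj C \<Longrightarrow> a \<in> carrier (A t) \<Longrightarrow> \<one>\<^bsub>A t\<^esub> \<otimes>\<^bsub>A t\<^esub> a = a"
  "t \<in> Obj C \<Longrightarrow> a \<in> carrier (A t) \<Longrightarrow> a \<otimes>\<^bsub>A t\<^esub> \<one>\<^bsub>A t\<^esub> = a"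
  using monoid.l_one[OF monoid_A] monoid.r_one[OF monoid_A] by auto

lemma pull_closed: "\<alpha> \<in> hom_set C s t \<Longrightarrow> a \<in> carrier (A t) \<Longrightarrow> pull \<alpha> a \<in> carrier (A s)"
  using pull_hom[of \<alpha> s t] by (auto simp: monoid_hom_def hom_def)

lemma pull_mult:
  "\<lbrakk>\<alpha> \<in> hom_set C s t; a \<in> carrier (A t); b \<in> carrier (A t)\<rbrakk>
    \<Longrightarrow> pull \<alpha> (a \<otimes>\<^bsub>A t\<^esub> b) = pull \<alpha> a \<otimes>\<^bsub>A s\<^esub> pull \<alpha> b"
  using pull_hom[of \<alpha> s t] by (auto simp: monoid_hom_def hom_def)

lemma pull_one: "\<alpha> \<in> hom_set C s t \<Longrightarrow> pull \<alpha> \<one>\<^bsub>A t\<^esub> = \<one>\<^bsub>A s\<^esub>"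
  using pull_hom[of \<alpha> s t] by (auto simp: monoid_hom_def)

lemma bd_in: "t \<in> Obj C \<Longrightarrow> a \<in> carrier (A t) \<Longrightarrow> bd t a \<in> hom_set C t t"
  using bd_hom[of t] by (auto simp: monoid_hom_def hom_def end_monoid_def)

lemma bd_mult:
  "\<lbrakk>t \<in> Obj C; a \<in> carrier (A t); b \<in> carrier (A t)\<rbrakk> \<Longrightarrow> bd t (a \<otimes>\<^bsub>A t\<^esub> b) = bd t a \<diamondop> bd t b"
  using bd_hom[of t] by (auto simp: monoid_hom_def hom_def end_monoid_def)

lemma bd_one: "t \<in> Obj C \<Longrightarrow> bd t \<one>\<^bsub>A t\<^esub> = ident C t"
  using bd_hom[of t] by (auto simp: monoid_hom_def end_monoid_def)

text \<open>
  Moving \<open>Q\<close> along the morphism \<open>E\<close> turns a decoration at the target of \<open>E\<close> into one at its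
  source. This is the rule by which the edges of a matrix compose (\<open>edge_via\<close>).
\<close>

lemma bd_mult_comp:
  assumes E: "E \<in> hom_set C s t" and G: "G \<in> hom_set C r s"
    and P: "P \<in> carrier (A t)" and Q: "Q \<in> carrier (A t)" and T: "T \<in> carrier (A s)"
  shows "bd t (P \<otimes>\<^bsub>A t\<^esub> Q) \<diamondop> E \<diamondop> bd s T \<diamondop> G
    = (bd t P \<diamondop> E) \<diamondop> bd s (pull E Q \<otimes>\<^bsub>A s\<^esub> T) \<diamondop> G"
proof -
  note s = hom_obj(1)[OF E] and t = hom_obj(2)[OF E]
  note P' = bd_in[OF t P] and Q' = bd_in[OF t Q] and T' = bd_in[OF s T]
  note EQ = pull_closed[OF E Q]
  note EQ' = bd_in[OF s EQ]
  note TG = comp_in[OF T' G]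
  have "bd t (P \<otimes>\<^bsub>A t\<^esub> Q) \<diamondop> E \<diamondop> bd s T \<diamondop> G = bd t P \<diamondop> bd t Q \<diamondop> E \<diamondop> bd s T \<diamondop> G"
    using comp_assoc[OF P' Q' comp_in[OF E TG]] by (simp add: bd_mult t P Q)
  also have "bd t Q \<diamondop> E \<diamondop> bd s T \<diamondop> G = (E \<diamondop> bd s (pull E Q)) \<diamondop> bd s T \<diamondop> G"
    using comp_assoc[OF Q' E TG] bd_pull[OF E Q] by simp
  also have "\<dots> = E \<diamondop> bd s (pull E Q) \<diamondop> bd s T \<diamondop> G" by (rule comp_assoc[OF E EQ' TG])
  also have "bd s (pull E Q) \<diamondop> bd s T \<diamondop> G = bd s (pull E Q \<otimes>\<^bsub>A s\<^esub> T) \<diamondop> G"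
    using comp_assoc[OF EQ' T' G] by (simp add: bd_mult s EQ T)
  also have "bd t P \<diamondop> E \<diamondop> \<dots> = (bd t P \<diamondop> E) \<diamondop> bd s (pull E Q \<otimes>\<^bsub>A s\<^esub> T) \<diamondop> G"
    using comp_assoc[OF P' E comp_in[OF bd_in[OF s mult_closed[OF s EQ T]] G]] by simp
  finally show ?thesis .
qed

text \<open>
  The Peiffer relation in the form in which it reorders the factors of \<open>tri\<close>. The exponents
  \<open>\<eta>\<^sub>k\<close> in the definition of the face maps of the nerve arise from this exchange.
\<close>

lemma peiffer_pull:
  assumes E: "E \<in> hom_set C s t" and R: "R \<in> carrier (A t)" and T: "T \<in> carrier (A s)"
  shows "pull E R \<otimes>\<^bsub>A s\<^esub> T = T \<otimes>\<^bsub>A s\<^esub> pull (E \<diamondop> bd s T) R"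
  using peiffer[OF hom_obj(1)[OF E] pull_closed[OF E R] T] pull_comp[OF E bd_in[OF hom_obj(1)[OF E] T] R]
  by simp

section \<open>Entries of matrices in the nerve\<close>

definition verts :: "('o, 'm, 'a) nerve_simplex \<Rightarrow> nat \<Rightarrow> 'o"
  where "verts M i = (case M of Vertex p \<Rightarrow> p | Matrix d u \<Rightarrow> diag_obj C d i)"

definition diag :: "('o, 'm, 'a) nerve_simplex \<Rightarrow> nat \<Rightarrow> 'm"
  where "diag M i = (case M of Vertex p \<Rightarrow> undefined | Matrix d u \<Rightarrow> d i)"

definition entry :: "('o, 'm, 'a) nerve_simplex \<Rightarrow> nat \<Rightarrow> nat \<Rightarrow> 'a"
  where "entry M i k = (case M of Vertex p \<Rightarrow> undefined | Matrix d u \<Rightarrow> u i k)"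

lemma mk_matrix_sel:
  "1 \<le> i \<Longrightarrow> i \<le> n \<Longrightarrow> diag (mk_matrix n d u) i = d i"
  "1 \<le> i \<Longrightarrow> i < k \<Longrightarrow> k \<le> n \<Longrightarrow> entry (mk_matrix n d u) i k = u i k"
  by (auto simp: diag_def entry_def mk_matrix_def)

lemma mk_matrix_in:
  assumes "n > 0" and x: "\<And>i. i \<le> n \<Longrightarrow> x i \<in> Obj C"
    and d: "\<And>i. i < n \<Longrightarrow> d (Suc i) \<in> hom_set C (x (Suc i)) (x i)"
    and u: "\<And>i k. i < k \<Longrightarrow> k < n \<Longrightarrow> u (Suc i) (Suc k) \<in> carrier (A (x (Suc i)))"
  shows "mk_matrix n d u \<in> nerve_simplices C A n"
    and "i \<le> n \<Longrightarrow> verts (mk_matrix n d u) i = x i"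
proof -
  have d': "d j \<in> hom_set C (x j) (x (j - 1))" if "1 \<le> j" "j \<le> n" for j
    using d[of "j - 1"] that by simp
  have u': "u i j \<in> carrier (A (x i))" if "1 \<le> i" "i < j" "j \<le> n" for i j
    using u[of "i - 1" "j - 1"] that by simp
  show "mk_matrix n d u \<in> nerve_simplices C A n"
    unfolding nerve_simplices_def using assms(1) x d' u'
    by (simp del: One_nat_def) (intro exI[of _ d] exI[of _ u] conjI refl exI[of _ x]; simp)
  show "verts (mk_matrix n d u) i = x i" if "i \<le> n"
    using that assms(1) d'[of 1] d'[of i]
    by (auto simp: verts_def mk_matrix_def diag_obj_def hom_set_def)
qed

lemma nerve_simplexE:
  assumes "M \<in> nerve_simplices C A n"
  obtains (vertex) p where "n = 0" "p \<in> Obj C" "M = Vertex p"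
  | (matrix) d u x where "n > 0" "\<And>i. i \<le> n \<Longrightarrow> x i \<in> Obj C"
      "\<And>i. i < n \<Longrightarrow> d (Suc i) \<in> hom_set C (x (Suc i)) (x i)"
      "\<And>i k. i < k \<Longrightarrow> k < n \<Longrightarrow> u (Suc i) (Suc k) \<in> carrier (A (x (Suc i)))"
      "M = mk_matrix n d u"
proof (cases "n = 0")
  case False
  then obtain d u and x :: "nat \<Rightarrow> 'o" where M: "M = mk_matrix n d u" and x: "\<forall>j\<le>n. x j \<in> Obj C"
      and d: "\<forall>j. 1 \<le> j \<and> j \<le> n \<longrightarrow> d j \<in> hom_set C (x j) (x (j - 1))"
      and u: "\<forall>i j. 1 \<le> i \<and> i < j \<and> j \<le> n \<longrightarrow> u i j \<in> carrier (A (x i))"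
    using assms by (auto simp: nerve_simplices_def)
  have "d (Suc i) \<in> hom_set C (x (Suc i)) (x i)" if "i < n" for i using d[rule_format, of "Suc i"] that by simp
  moreover have "u (Suc i) (Suc k) \<in> carrier (A (x (Suc i)))" if "i < k" "k < n" for i k
    using u[rule_format, of "Suc i" "Suc k"] that by simp
  ultimately show ?thesis using matrix[of x d u] False M x by blast
qed (use assms vertex in \<open>auto simp: nerve_simplices_def\<close>)

lemma
  assumes "M \<in> nerve_simplices C A n"
  shows verts_in: "i \<le> n \<Longrightarrow> verts M i \<in> Obj C"
    and diag_in: "i < n \<Longrightarrow> diag M (Suc i) \<in> hom_set C (verts M (Suc i)) (verts M i)"
    and entry_in: "Suc i < k \<Longrightarrow> k \<le> n \<Longrightarrow> entry M (Suc i) k \<in> carrier (A (verts M (Suc i)))"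
proof -
  have "(i \<le> n \<longrightarrow> verts M i \<in> Obj C) \<and> (i < n \<longrightarrow> diag M (Suc i) \<in> hom_set C (verts M (Suc i)) (verts M i))
    \<and> (Suc i < k \<longrightarrow> k \<le> n \<longrightarrow> entry M (Suc i) k \<in> carrier (A (verts M (Suc i))))" for i k
    using assms
  proof (cases rule: nerve_simplexE)
    case (vertex p)
    then show ?thesis by (simp add: verts_def)
  next
    case (matrix d u x)
    note v = mk_matrix_in(2)[OF matrix(1), of x d u, OF matrix(2-4)]
    show ?thesis using matrix v matrix(4)[of i "k - 1"] by (auto simp: mk_matrix_sel)
  qed
  then show "i \<le> n \<Longrightarrow> verts M i \<in> Obj C"
    "i < n \<Longrightarrow> diag M (Suc i) \<in> hom_set C (verts M (Suc i)) (verts M i)"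
    "Suc i < k \<Longrightarrow> k \<le> n \<Longrightarrow> entry M (Suc i) k \<in> carrier (A (verts M (Suc i)))" by auto
qed

lemma nerve_simplex_eqI:
  assumes M: "M \<in> nerve_simplices C A n" and M': "M' \<in> nerve_simplices C A n"
    and v: "verts M 0 = verts M' 0" and d: "\<And>i. i < n \<Longrightarrow> diag M (Suc i) = diag M' (Suc i)"
    and u: "\<And>i k. i < k \<Longrightarrow> k < n \<Longrightarrow> entry M (Suc i) (Suc k) = entry M' (Suc i) (Suc k)"
  shows "M = M'"
  using M
proof (cases rule: nerve_simplexE)
  case (vertex p)
  then show ?thesis using M' v by (auto simp: nerve_simplices_def verts_def)
next
  case m: (matrix d1 u1 x1)
  show ?thesis using M'
  proof (cases rule: nerve_simplexE)
    case m': (matrix d2 u2 x2)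
    have "d1 i = d2 i" if "1 \<le> i" "i \<le> n" for i
      using d[of "i - 1"] that m m' by (auto simp: mk_matrix_sel)
    moreover have "u1 i k = u2 i k" if "1 \<le> i" "i < k" "k \<le> n" for i k
      using u[of "i - 1" "k - 1"] that m m' by (auto simp: mk_matrix_sel)
    ultimately show ?thesis using m(5) m'(5) by (auto simp: mk_matrix_def fun_eq_iff)
  qed (use m in simp)
qed

section \<open>The low-dimensional faces of a matrix\<close>

text \<open>
  The product \<open>m\<^sub>i\<^sub>,\<^sub>j\<^sub>+\<^sub>1 \<cdots> m\<^sub>i\<^sub>k\<close> of consecutive entries of row \<open>i\<close>. Under left cancellation it
  is the only \<open>b\<close> that belongs to the 3-dimensional face on the vertices \<open>i - 1, i, j, k\<close>
  (see \<open>coherent\<close>).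
\<close>

definition seg :: "('o, 'm, 'a) nerve_simplex \<Rightarrow> nat \<Rightarrow> nat \<Rightarrow> nat \<Rightarrow> 'a"
  where "seg M i j k = ordered_prod (A (verts M i)) (map (entry M i) [Suc j..<Suc k])"

text \<open>
  The 1-dimensional face on the vertices \<open>i \<le> j\<close> and, below, the entry above the diagonal of the
  2-dimensional face on \<open>i \<le> j \<le> k\<close>. For \<open>i < j\<close> both recursions split off the vertex
  \<open>i + 1\<close>: \<open>seg M (i + 1) (i + 1) j\<close> decorates the triangle \<open>i, i + 1, j\<close>, and the 3-dimensional
  face on \<open>i, i + 1, j, k\<close> expresses its face \<open>i, j, k\<close> through \<open>i + 1, j, k\<close>.
\<close>

function edge :: "('o, 'm, 'a) nerve_simplex \<Rightarrow> nat \<Rightarrow> nat \<Rightarrow> 'm"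
  where "edge M i j = (if i < j
    then diag M (Suc i) \<diamondop> bd (verts M (Suc i)) (seg M (Suc i) (Suc i) j) \<diamondop> edge M (Suc i) j
    else ident C (verts M i))"
  by auto
termination by (relation "measure (\<lambda>(M, i, j). j - i)") auto

function tri :: "('o, 'm, 'a) nerve_simplex \<Rightarrow> nat \<Rightarrow> nat \<Rightarrow> nat \<Rightarrow> 'a"
  where "tri M i j k = (if i < j
    then pull (edge M (Suc i) j) (seg M (Suc i) j k) \<otimes>\<^bsub>A (verts M j)\<^esub> tri M (Suc i) j k
    else \<one>\<^bsub>A (verts M j)\<^esub>)"
  by auto
termination by (relation "measure (\<lambda>(M, i, j, k). j - i)") auto

declare edge.simps [simp del] tri.simps [simp del]

lemma edge_refl [simp]: "edge M i i = ident C (verts M i)"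
  and tri_refl [simp]: "tri M i i k = \<one>\<^bsub>A (verts M i)\<^esub>"
  by (simp_all add: edge.simps[of M i i] tri.simps[of M i i])

lemma edge_less: "i < j \<Longrightarrow> edge M i j =
    diag M (Suc i) \<diamondop> bd (verts M (Suc i)) (seg M (Suc i) (Suc i) j) \<diamondop> edge M (Suc i) j"
  and tri_less: "i < j \<Longrightarrow> tri M i j k =
    pull (edge M (Suc i) j) (seg M (Suc i) j k) \<otimes>\<^bsub>A (verts M j)\<^esub> tri M (Suc i) j k"
  by (simp_all add: edge.simps[of M i j] tri.simps[of M i j])

lemma seg_refl [simp]: "seg M i k k = \<one>\<^bsub>A (verts M i)\<^esub>"
  by (simp add: seg_def)

text \<open>
  What a simplex looks like on its faces of dimension at most 2, where \<open>a i j k\<close> decorates the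
  triangle \<open>i, j, k\<close> at its middle vertex. The last condition says that the four triangles on
  \<open>i, j, k, l\<close> bound a 3-simplex, \<open>b\<close> being the entry in its upper right corner. The conditions
  for repeated indices normalize the degenerate faces, so that the notion is stable under
  reindexing along every monotone map, injective or not.
\<close>

definition coherent :: "nat \<Rightarrow> (nat \<Rightarrow> 'o) \<Rightarrow> (nat \<Rightarrow> nat \<Rightarrow> 'm) \<Rightarrow> (nat \<Rightarrow> nat \<Rightarrow> nat \<Rightarrow> 'a) \<Rightarrow> bool"
  where "coherent n x f a \<longleftrightarrow>
    (\<forall>i\<le>n. x i \<in> Obj C \<and> f i i = ident C (x i)) \<and>
    (\<forall>i j. i \<le> j \<and> j \<le> n \<longrightarrow> f i j \<in> hom_set C (x j) (x i)
      \<and> a i i j = \<one>\<^bsub>A (x i)\<^esub> \<and> a i j j = \<one>\<^bsub>A (x j)\<^esub>) \<and>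
    (\<forall>i j k. i \<le> j \<and> j \<le> k \<and> k \<le> n \<longrightarrow> a i j k \<in> carrier (A (x j))
      \<and> f i k = f i j \<diamondop> bd (x j) (a i j k) \<diamondop> f j k) \<and>
    (\<forall>i j k l. i \<le> j \<and> j \<le> k \<and> k \<le> l \<and> l \<le> n \<longrightarrow> (\<exists>b\<in>carrier (A (x j)).
      a i j l = a i j k \<otimes>\<^bsub>A (x j)\<^esub> b \<and> a i k l = pull (f j k) b \<otimes>\<^bsub>A (x k)\<^esub> a j k l))"

lemma coherent_reindex:
  assumes c: "coherent n x f a" and h: "mono_on {..m} h" "h ` {..m} \<subseteq> {..n}"
  shows "coherent m (\<lambda>i. x (h i)) (\<lambda>i j. f (h i) (h j)) (\<lambda>i j k. a (h i) (h j) (h k))"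
proof -
  have h': "i \<le> j \<Longrightarrow> j \<le> m \<Longrightarrow> h i \<le> h j" "i \<le> m \<Longrightarrow> h i \<le> n" for i j
    using h by (auto simp: mono_on_def)
  show ?thesis using c unfolding coherent_def by (auto simp: h')
qed

lemma coherent_cong:
  assumes c: "coherent n x' f' a'" and x: "\<And>i. i \<le> n \<Longrightarrow> x i = x' i"
    and f: "\<And>i j. i \<le> j \<Longrightarrow> j \<le> n \<Longrightarrow> f i j = f' i j"
    and a: "\<And>i j k. i \<le> j \<Longrightarrow> j \<le> k \<Longrightarrow> k \<le> n \<Longrightarrow> a i j k = a' i j k"
  shows "coherent n x f a"
  using c unfolding coherent_def by (simp add: x f a)

text \<open>
  No condition involves more than four vertices; this is where the number 3 in the theorem comes
  from.
\<close>

lemma coherent_local: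
  assumes loc: "\<And>i j k l. i \<le> j \<Longrightarrow> j \<le> k \<Longrightarrow> k \<le> l \<Longrightarrow> l \<le> n \<Longrightarrow>
    coherent 3 (\<lambda>p. x ([i, j, k, l] ! p)) (\<lambda>p q. f ([i, j, k, l] ! p) ([i, j, k, l] ! q))
      (\<lambda>p q r. a ([i, j, k, l] ! p) ([i, j, k, l] ! q) ([i, j, k, l] ! r))"
  shows "coherent n x f a"
proof -
  have *: "x i \<in> Obj C \<and> f i i = ident C (x i) \<and>
      f i j \<in> hom_set C (x j) (x i) \<and> a i i j = \<one>\<^bsub>A (x i)\<^esub> \<and> a i j j = \<one>\<^bsub>A (x j)\<^esub> \<and>
      a i j k \<in> carrier (A (x j)) \<and> f i k = f i j \<diamondop> bd (x j) (a i j k) \<diamondop> f j k \<and>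
      (\<exists>b\<in>carrier (A (x j)). a i j l = a i j k \<otimes>\<^bsub>A (x j)\<^esub> b \<and> a i k l = pull (f j k) b \<otimes>\<^bsub>A (x k)\<^esub> a j k l)"
    if "i \<le> j" "j \<le> k" "k \<le> l" "l \<le> n" for i j k l
  proof -
    let ?h = "(!) [i, j, k, l]"
    have h: "?h 0 = i" "?h 1 = j" "?h 2 = k" "?h 3 = l" by (simp_all add: numeral_2_eq_2 numeral_3_eq_3)
    note c = loc[OF that, unfolded coherent_def]
    show ?thesis
      using c[THEN conjunct1, rule_format, of 0]
        c[THEN conjunct2, THEN conjunct1, rule_format, of 0 1]
        c[THEN conjunct2, THEN conjunct2, THEN conjunct1, rule_format, of 0 1 2]
        c[THEN conjunct2, THEN conjunct2, THEN conjunct2, rule_format, of 0 1 2 3]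
      unfolding h by simp
  qed
  show ?thesis
    unfolding coherent_def
  proof (intro conjI allI impI; (elim conjE)?)
  qed (use * in blast)+
qed

context
  fixes M n
  assumes M: "M \<in> nerve_simplices C A n"
begin

lemma seg_entries:
  assumes "i \<le> j" "k \<le> n"
  shows "set (map (entry M (Suc i)) [Suc (Suc j)..<Suc k]) \<subseteq> carrier (A (verts M (Suc i)))"
  using entry_in[OF M] assms by auto

lemma seg_closed: "i < j \<Longrightarrow> k \<le> n \<Longrightarrow> i < n \<Longrightarrow> seg M (Suc i) j k \<in> carrier (A (verts M (Suc i)))"
  using seg_entries[of i "j - 1" k] ordered_prod_closed[OF monoid_A[OF verts_in[OF M]], of "Suc i"]
  by (simp add: seg_def)

lemma seg_mult:
  assumes "i < j" "j \<le> k" "k \<le> l" "l \<le> n"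
  shows "seg M (Suc i) j l = seg M (Suc i) j k \<otimes>\<^bsub>A (verts M (Suc i))\<^esub> seg M (Suc i) k l"
proof -
  have "[Suc j..<Suc l] = [Suc j..<Suc k] @ [Suc k..<Suc l]"
    using upt_add_eq_append[of "Suc j" "Suc k" "l - k"] assms by simp
  then show ?thesis
    using seg_entries[of i "j - 1" k] seg_entries[of i "k - 1" l] assms
      ordered_prod_append[OF monoid_A[OF verts_in[OF M]], of "Suc i"]
    by (simp add: seg_def del: upt_Suc)
qed

lemma seg_single:
  assumes "i < k" "k < n"
  shows "seg M (Suc i) k (Suc k) = entry M (Suc i) (Suc k)"
  using assms entry_in[OF M] verts_in[OF M]
  by (simp add: seg_def ordered_prod_def mult_one)

lemma edge_in: "i \<le> j \<Longrightarrow> j \<le> n \<Longrightarrow> edge M i j \<in> hom_set C (verts M j) (verts M i)"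
proof (induction i rule: inc_induct)
  case base
  then show ?case using ident_in verts_in[OF M] by simp
next
  case (step i)
  then show ?case
    using comp_in[OF diag_in[OF M] comp_in[OF bd_in[OF verts_in[OF M] seg_closed]]]
    by (simp add: edge_less)
qed

lemma tri_in: "i \<le> j \<Longrightarrow> j \<le> k \<Longrightarrow> k \<le> n \<Longrightarrow> tri M i j k \<in> carrier (A (verts M j))"
proof (induction i rule: inc_induct)
  case base
  then show ?case using one_closed verts_in[OF M] by simp
next
  case (step i)
  then show ?case
    using mult_closed[OF verts_in[OF M] pull_closed[OF edge_in seg_closed]]
    by (simp add: tri_less)
qed

lemma edge_diag: "i < n \<Longrightarrow> edge M i (Suc i) = diag M (Suc i)"
  using diag_in[OF M] ident_in verts_in[OF M] ident_left[OF ident_in] ident_right[OF diag_in[OF M]]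
  by (simp add: edge_less bd_one)

lemma tri_seg: "i < k \<Longrightarrow> k \<le> n \<Longrightarrow> tri M i (Suc i) k = seg M (Suc i) (Suc i) k"
  using seg_closed[of i "Suc i" k] verts_in[OF M]
  by (simp add: tri_less pull_ident mult_one)

lemma tri_repeat: "i \<le> j \<Longrightarrow> j \<le> n \<Longrightarrow> tri M i j j = \<one>\<^bsub>A (verts M j)\<^esub>"
proof (induction i rule: inc_induct)
  case (step i)
  then show ?case using pull_one[OF edge_in] one_closed verts_in[OF M] mult_one
    by (simp add: tri_less)
qed simp

text \<open>
  Splitting off the vertex \<open>i + 1\<close> reduces the composition rule to the one for \<open>i + 1, j, k\<close>.
\<close>

lemma edge_via: "i \<le> j \<Longrightarrow> j \<le> k \<Longrightarrow> k \<le> n \<Longrightarrow>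
  edge M i k = edge M i j \<diamondop> bd (verts M j) (tri M i j k) \<diamondop> edge M j k"
proof (induction i rule: inc_induct)
  case base
  then show ?case using ident_left[OF edge_in] ident_left[OF ident_in] verts_in[OF M]
    by (simp add: bd_one)
next
  case (step i)
  have E: "edge M (Suc i) j \<in> hom_set C (verts M j) (verts M (Suc i))"
    and G: "edge M j k \<in> hom_set C (verts M k) (verts M j)"
    and D: "diag M (Suc i) \<in> hom_set C (verts M (Suc i)) (verts M i)"
    and P: "seg M (Suc i) (Suc i) j \<in> carrier (A (verts M (Suc i)))"
    and Q: "seg M (Suc i) j k \<in> carrier (A (verts M (Suc i)))"
    and T: "tri M (Suc i) j k \<in> carrier (A (verts M j))"
    using step edge_in diag_in[OF M] seg_closed tri_in by auto
  note x = hom_obj[OF E]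
  let ?B = "bd (verts M (Suc i)) (seg M (Suc i) (Suc i) j)" and ?t = "tri M i j k"
  have t: "?t = pull (edge M (Suc i) j) (seg M (Suc i) j k) \<otimes>\<^bsub>A (verts M j)\<^esub> tri M (Suc i) j k"
    using step by (simp add: tri_less)
  have "edge M i k = diag M (Suc i) \<diamondop> bd (verts M (Suc i))
      (seg M (Suc i) (Suc i) j \<otimes>\<^bsub>A (verts M (Suc i))\<^esub> seg M (Suc i) j k) \<diamondop> edge M (Suc i) k"
    using step seg_mult[of i "Suc i" j k] by (simp add: edge_less)
  also have "\<dots> = diag M (Suc i) \<diamondop> (?B \<diamondop> edge M (Suc i) j) \<diamondop> bd (verts M j) ?t \<diamondop> edge M j k"
    using step bd_mult_comp[OF E G P Q T] by (simp add: t)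
  also have "\<dots> = (diag M (Suc i) \<diamondop> ?B \<diamondop> edge M (Suc i) j) \<diamondop> bd (verts M j) ?t \<diamondop> edge M j k"
    using comp_assoc[OF D comp_in[OF bd_in[OF x(2) P] E] comp_in[OF bd_in[OF x(1), of ?t] G]]
      tri_in[of i j k] step by simp
  finally show ?case using step by (simp add: edge_less)
qed

text \<open>
  The witness is built along the recursion of \<open>tri\<close>: passing from \<open>i + 1\<close> to \<open>i\<close> multiplies
  it on the left by \<open>seg M (i + 1) k l\<close>, pulled back along the morphism that follows \<open>edge M j k\<close>
  in the decomposition of \<open>edge M (i + 1) k\<close> by \<open>edge_via\<close>. The Peiffer relation brings the
  factors of \<open>tri M i j l\<close> into the order that the first equation asks for.
\<close>

lemma tri_tetrahedron: "i \<le> j \<Longrightarrow> j \<le> k \<Longrightarrow> k \<le> l \<Longrightarrow> l \<le> n \<Longrightarrow>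
  \<exists>b\<in>carrier (A (verts M j)). tri M i j l = tri M i j k \<otimes>\<^bsub>A (verts M j)\<^esub> b
    \<and> tri M i k l = pull (edge M j k) b \<otimes>\<^bsub>A (verts M k)\<^esub> tri M j k l"
proof (induction i rule: inc_induct)
  case base
  have "tri M j k l \<in> carrier (A (verts M k))" using base by (simp add: tri_in)
  then show ?case
    using base one_closed verts_in[OF M] mult_one pull_one[OF edge_in]
    by (intro bexI[of _ "\<one>\<^bsub>A (verts M j)\<^esub>"]) auto
next
  case (step i)
  let ?E = "edge M (Suc i) j" and ?G = "edge M j k" and ?T = "tri M (Suc i) j k"
  let ?Q = "seg M (Suc i) j k" and ?R = "seg M (Suc i) k l"
  obtain b where b: "b \<in> carrier (A (verts M j))"
      "tri M (Suc i) j l = ?T \<otimes>\<^bsub>A (verts M j)\<^esub> b"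
      "tri M (Suc i) k l = pull ?G b \<otimes>\<^bsub>A (verts M k)\<^esub> tri M j k l"
    using step by auto
  have E: "?E \<in> hom_set C (verts M j) (verts M (Suc i))"
    and G: "?G \<in> hom_set C (verts M k) (verts M j)"
    and Q: "?Q \<in> carrier (A (verts M (Suc i)))"
    and R: "?R \<in> carrier (A (verts M (Suc i)))"
    and T: "?T \<in> carrier (A (verts M j))"
    and T': "tri M j k l \<in> carrier (A (verts M k))"
    using step edge_in seg_closed tri_in by auto
  note x = hom_obj(1)[OF E] hom_obj(1)[OF G]
  note B = bd_in[OF x(1) T]
  note EB = comp_in[OF E B]
  note ER = pull_closed[OF E R] and EQ = pull_closed[OF E Q] and EBR = pull_closed[OF EB R]
  let ?b = "pull (?E \<diamondop> bd (verts M j) ?T) ?R \<otimes>\<^bsub>A (verts M j)\<^esub> b"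
  have bin: "?b \<in> carrier (A (verts M j))" using mult_closed x EBR b by simp
  have "tri M i j l = (pull ?E ?Q \<otimes>\<^bsub>A (verts M j)\<^esub> pull ?E ?R) \<otimes>\<^bsub>A (verts M j)\<^esub> (?T \<otimes>\<^bsub>A (verts M j)\<^esub> b)"
    using step b seg_mult[of i j k l] pull_mult[OF E Q R] by (simp add: tri_less)
  also have "\<dots> = pull ?E ?Q \<otimes>\<^bsub>A (verts M j)\<^esub> ((pull ?E ?R \<otimes>\<^bsub>A (verts M j)\<^esub> ?T) \<otimes>\<^bsub>A (verts M j)\<^esub> b)"
    using x ER EQ T b by (simp add: mult_assoc mult_closed)
  also have "\<dots> = (pull ?E ?Q \<otimes>\<^bsub>A (verts M j)\<^esub> ?T) \<otimes>\<^bsub>A (verts M j)\<^esub> ?b"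
    using x EQ T b EBR by (simp add: mult_assoc mult_closed peiffer_pull[OF E R T])
  finally have 1: "tri M i j l = tri M i j k \<otimes>\<^bsub>A (verts M j)\<^esub> ?b"
    using step by (simp add: tri_less)
  \<comment> \<open>The exponent of \<open>?R\<close> in \<open>tri M i k l\<close> is the one in \<open>?b\<close>, continued along \<open>edge M j k\<close>.\<close>
  have "edge M (Suc i) k = (?E \<diamondop> bd (verts M j) ?T) \<diamondop> ?G"
    using edge_via[of "Suc i" j k] step comp_assoc[OF E B G] by simp
  then have "tri M i k l = pull ?G (pull (?E \<diamondop> bd (verts M j) ?T) ?R)
      \<otimes>\<^bsub>A (verts M k)\<^esub> (pull ?G b \<otimes>\<^bsub>A (verts M k)\<^esub> tri M j k l)"
    using step b pull_comp[OF EB G R] by (simp add: tri_less)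
  also have "\<dots> = pull ?G ?b \<otimes>\<^bsub>A (verts M k)\<^esub> tri M j k l"
    using x b T' pull_closed[OF G EBR] pull_closed[OF G b(1)] pull_mult[OF G EBR b(1)]
    by (simp add: mult_assoc)
  finally show ?case using 1 bin by blast
qed

lemma coherent_nerve: "coherent n (verts M) (edge M) (tri M)"
  unfolding coherent_def
  by (intro conjI allI impI; (elim conjE)?)
    (rule verts_in[OF M] edge_in tri_in tri_repeat edge_via tri_tetrahedron edge_refl tri_refl; assumption)+

end

section \<open>Matrices from coherent families\<close>

text \<open>
  A coherent family is the family of faces of the matrix whose entries are the \<open>b\<close> of the
  3-dimensional faces on \<open>i, i + 1, k, k + 1\<close>. Products of entries in a row telescope to the
  decorations of the triangles starting with \<open>i, i + 1\<close>; cancelling these on the left identifies the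
  remaining products with the \<open>b\<close> of \<open>i, i + 1, j, k\<close>, and the recursions for \<open>edge\<close> and \<open>tri\<close>
  do the rest. The lemma serves three purposes: it computes the faces and the degeneracies of
  a matrix, and it fills families of compatible 3-simplices.
\<close>

lemma realize_coherent:
  assumes c: "coherent n x f a"
    and M: "M = (if n = 0 then Vertex (x 0) else mk_matrix n d u)"
    and d: "\<And>i. i < n \<Longrightarrow> d (Suc i) = f i (Suc i)"
    and u: "\<And>i k. i < k \<Longrightarrow> k < n \<Longrightarrow> u (Suc i) (Suc k) \<in> carrier (A (x (Suc i)))"
      "\<And>i k. i < k \<Longrightarrow> k < n \<Longrightarrow>
        a i (Suc i) (Suc k) = a i (Suc i) k \<otimes>\<^bsub>A (x (Suc i))\<^esub> u (Suc i) (Suc k)"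
    and canc: "\<And>i. i \<le> n \<Longrightarrow> left_cancellative (A (x i))"
  shows "M \<in> nerve_simplices C A n"
    and "i \<le> n \<Longrightarrow> verts M i = x i"
    and "i \<le> j \<Longrightarrow> j \<le> n \<Longrightarrow> edge M i j = f i j"
    and "i \<le> j \<Longrightarrow> j \<le> k \<Longrightarrow> k \<le> n \<Longrightarrow> tri M i j k = a i j k"
proof -
  have x: "i \<le> n \<Longrightarrow> x i \<in> Obj C" and fid: "i \<le> n \<Longrightarrow> f i i = ident C (x i)"
    and f: "i \<le> j \<Longrightarrow> j \<le> n \<Longrightarrow> f i j \<in> hom_set C (x j) (x i)"
    and a1: "i \<le> j \<Longrightarrow> j \<le> n \<Longrightarrow> a i i j = \<one>\<^bsub>A (x i)\<^esub>" "i \<le> j \<Longrightarrow> j \<le> n \<Longrightarrow> a i j j = \<one>\<^bsub>A (x j)\<^esub>"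
    and a: "i \<le> j \<Longrightarrow> j \<le> k \<Longrightarrow> k \<le> n \<Longrightarrow> a i j k \<in> carrier (A (x j))"
    and fvia: "i \<le> j \<Longrightarrow> j \<le> k \<Longrightarrow> k \<le> n \<Longrightarrow> f i k = f i j \<diamondop> bd (x j) (a i j k) \<diamondop> f j k"
    and tet: "i \<le> j \<Longrightarrow> j \<le> k \<Longrightarrow> k \<le> l \<Longrightarrow> l \<le> n \<Longrightarrow> \<exists>b\<in>carrier (A (x j)).
      a i j l = a i j k \<otimes>\<^bsub>A (x j)\<^esub> b \<and> a i k l = pull (f j k) b \<otimes>\<^bsub>A (x k)\<^esub> a j k l" for i j k l
    using c unfolding coherent_def by blast+
  have Mv: "M \<in> nerve_simplices C A n \<and> (\<forall>i\<le>n. verts M i = x i)"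
  proof (cases "n = 0")
    case True
    then show ?thesis using M x by (simp add: nerve_simplices_def verts_def)
  next
    case False
    have "\<And>i. i < n \<Longrightarrow> d (Suc i) \<in> hom_set C (x (Suc i)) (x i)" using d f by simp
    note mk_matrix_in[of n x d u, OF _ x this u(1)]
    then show ?thesis using False M by simp
  qed
  then show Min: "M \<in> nerve_simplices C A n" and v: "i \<le> n \<Longrightarrow> verts M i = x i" for i by auto
  have diag: "diag M (Suc i) = f i (Suc i)" if "i < n" for i
    using that M d by (simp add: mk_matrix_sel)
  have entry: "entry M (Suc i) (Suc k) = u (Suc i) (Suc k)" if "i < k" "k < n" for i k
    using that M by (simp add: mk_matrix_sel)
  have seg0: "seg M (Suc i) (Suc i) k = a i (Suc i) k" if "Suc i \<le> k" "k \<le> n" for i k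
    using that
  proof (induction k rule: dec_induct)
    case base
    then show ?case using a1 v by simp
  next
    case (step k)
    then show ?case
      using seg_mult[OF Min, of i "Suc i" k "Suc k"] seg_single[OF Min, of i k] u(2)[of i k] v entry by simp
  qed
  have seg: "a i j k = pull (f (Suc i) j) (seg M (Suc i) j k) \<otimes>\<^bsub>A (x j)\<^esub> a (Suc i) j k"
    if ijk: "i < j" "j \<le> k" "k \<le> n" for i j k
  proof -
    obtain b where b: "b \<in> carrier (A (x (Suc i)))"
      "a i (Suc i) k = a i (Suc i) j \<otimes>\<^bsub>A (x (Suc i))\<^esub> b"
      "a i j k = pull (f (Suc i) j) b \<otimes>\<^bsub>A (x j)\<^esub> a (Suc i) j k"
      using tet[of i "Suc i" j k] ijk by auto
    have "a i (Suc i) j \<otimes>\<^bsub>A (x (Suc i))\<^esub> b = a i (Suc i) j \<otimes>\<^bsub>A (x (Suc i))\<^esub> seg M (Suc i) j k"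
      using seg_mult[OF Min, of i "Suc i" j k] seg0[of i j] seg0[of i k] ijk b(2) v by simp
    then have "b = seg M (Suc i) j k"
      using canc[of "Suc i"] a[of i "Suc i" j] b(1) seg_closed[OF Min, of i j k] ijk v
      unfolding left_cancellative_def by simp
    then show ?thesis using b(3) by simp
  qed
  show e: "edge M i j = f i j" if "i \<le> j" "j \<le> n" for i j
    using that
  proof (induction i rule: inc_induct)
    case base
    then show ?case using fid v by simp
  next
    case (step i)
    then show ?case using fvia[of i "Suc i" j] seg0[of i j] diag[of i] v by (simp add: edge_less)
  qed
  show "tri M i j k = a i j k" if "i \<le> j" "j \<le> k" "k \<le> n"
    using that
  proof (induction i rule: inc_induct)
    case base
    then show ?case using a1 v by simp
  next
    case (step i)
    then show ?case using seg[of i j k] e v by (simp add: tri_less)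
  qed
qed

lemma nerve_face_eq:
  assumes "M \<in> nerve_simplices C A (Suc n)"
  shows "nerve_face C A pull bd (Suc n) j M =
    (if n = 0 then Vertex (if j = 0 then src C (diag M 1) else tgt C (diag M 1))
     else if j = 0 then mk_matrix n (\<lambda>i. diag M (Suc i)) (\<lambda>i k. entry M (Suc i) (Suc k))
     else if j = Suc n then mk_matrix n (diag M) (entry M)
     else mk_matrix n
      (\<lambda>i. if i < j then diag M i
        else if i = j then diag M j \<diamondop> bd (verts M j) (entry M j (Suc j)) \<diamondop> diag M (Suc j)
        else diag M (Suc i))
      (\<lambda>i k. if i < j then
          (if k < j then entry M i k
           else if k = j then entry M i j \<otimes>\<^bsub>A (verts M i)\<^esub> entry M i (Suc j)
           else entry M i (Suc k))
        else if i = j then pull (diag M (Suc j) \<diamondop> bd (verts M (Suc j)) (seg M (Suc j) (Suc j) k))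
            (entry M j (Suc k)) \<otimes>\<^bsub>A (verts M (Suc j))\<^esub> entry M (Suc j) (Suc k)
        else entry M (Suc i) (Suc k)))"
  using assms
proof (cases rule: nerve_simplexE)
  case (matrix d u x)
  then obtain d' u' where "M = Matrix d' u'" by (auto simp: mk_matrix_def)
  then show ?thesis
    by (simp add: nerve_face_def verts_def diag_def[abs_def] entry_def[abs_def] seg_def Let_def numeral_2_eq_2 del: upt_Suc cong: if_cong)
qed simp

lemma nerve_degen_eq:
  assumes "M \<in> nerve_simplices C A n" "j \<le> n"
  shows "nerve_degen C A n j M = mk_matrix (Suc n)
      (\<lambda>i. if i \<le> j then diag M i else if i = Suc j then ident C (verts M j) else diag M (i - 1))
      (\<lambda>i k. if i \<le> j then
          (if k \<le> j then entry M i k else if k = Suc j then \<one>\<^bsub>A (verts M i)\<^esub> else entry M i (k - 1))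
        else if i = Suc j then \<one>\<^bsub>A (verts M j)\<^esub>
        else entry M (i - 1) (k - 1))"
  using assms(1)
proof (cases rule: nerve_simplexE)
  case (vertex p)
  then show ?thesis using assms(2)
    by (auto simp: nerve_degen_def verts_def mk_matrix_def fun_eq_iff)
next
  case (matrix d u x)
  then obtain d' u' where "M = Matrix d' u'" by (auto simp: mk_matrix_def)
  then show ?thesis by (simp add: nerve_degen_def verts_def diag_def entry_def Let_def cong: if_cong)
qed

end

locale left_cancellative_crossed_monoid = crossed_monoid C A pull bd
  for C :: "('o, 'm) cat" and A :: "'o \<Rightarrow> 'a monoid" and pull bd +
  assumes left_cancel: "t \<in> Obj C \<Longrightarrow> left_cancellative (A t)"
begin

text \<open>
  The matrix of a face, as the definition of the nerve gives it, has the entries that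
  \<open>realize_coherent\<close> demands for the family of \<open>M\<close> restricted along the coface. Only the rows up to
  \<open>j\<close> differ from those of \<open>M\<close> by more than a shift, and in row \<open>j\<close> the Peiffer relation produces the
  exponent \<open>\<eta>\<^sub>k\<close>.
\<close>

lemma
  assumes M: "M \<in> nerve_simplices C A (Suc n)" and j: "j \<le> Suc n"
  shows nerve_face_in: "nerve_face C A pull bd (Suc n) j M \<in> nerve_simplices C A n"
    and verts_face: "i \<le> n \<Longrightarrow> verts (nerve_face C A pull bd (Suc n) j M) i = verts M (coface j i)"
    and edge_face: "i \<le> k \<Longrightarrow> k \<le> n \<Longrightarrow>
      edge (nerve_face C A pull bd (Suc n) j M) i k = edge M (coface j i) (coface j k)"
    and tri_face: "i \<le> k \<Longrightarrow> k \<le> l \<Longrightarrow> l \<le> n \<Longrightarrow>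
      tri (nerve_face C A pull bd (Suc n) j M) i k l = tri M (coface j i) (coface j k) (coface j l)"
proof -
  let ?F = "nerve_face C A pull bd (Suc n) j M"
  let ?x = "\<lambda>i. verts M (coface j i)" and ?f = "\<lambda>i k. edge M (coface j i) (coface j k)"
    and ?a = "\<lambda>i k l. tri M (coface j i) (coface j k) (coface j l)"
  note v = verts_in[OF M] and dg = diag_in[OF M] and en = entry_in[OF M]
  note c = coherent_reindex[OF coherent_nerve[OF M] coface_mono_on, of j]
  have canc: "left_cancellative (A (?x i))" if "i \<le> n" for i
    using that v coface_le left_cancel by simp
  have seg_Suc: "seg M (Suc i) (Suc i) (Suc k) = seg M (Suc i) (Suc i) k \<otimes>\<^bsub>A (verts M (Suc i))\<^esub> entry M (Suc i) (Suc k)"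
    if "i < k" "k < Suc n" for i k
    using seg_mult[OF M, of i "Suc i" k "Suc k"] seg_single[OF M, of i k] that by simp
  define d where "d = (if j = 0 then (\<lambda>i. diag M (Suc i)) else if j = Suc n then diag M else
      (\<lambda>i. if i < j then diag M i
        else if i = j then diag M j \<diamondop> bd (verts M j) (entry M j (Suc j)) \<diamondop> diag M (Suc j)
        else diag M (Suc i)))"
  define u where "u = (if j = 0 then (\<lambda>i k. entry M (Suc i) (Suc k)) else if j = Suc n then entry M else
      (\<lambda>i k. if i < j then
          (if k < j then entry M i k
           else if k = j then entry M i j \<otimes>\<^bsub>A (verts M i)\<^esub> entry M i (Suc j)
           else entry M i (Suc k))
        else if i = j then pull (diag M (Suc j) \<diamondop> bd (verts M (Suc j)) (seg M (Suc j) (Suc j) k))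
            (entry M j (Suc k)) \<otimes>\<^bsub>A (verts M (Suc j))\<^esub> entry M (Suc j) (Suc k)
        else entry M (Suc i) (Suc k)))"
  have F: "?F = (if n = 0 then Vertex (?x 0) else mk_matrix n d u)"
    using dg[of 0] by (auto simp: nerve_face_eq[OF M] d_def u_def coface_def hom_set_def)
  have d: "d (Suc i) = ?f i (Suc i)" if i: "i < n" for i
  proof -
    consider "Suc i < j" | "Suc i = j" | "j < Suc i" by linarith
    then show ?thesis
    proof cases
      case 2
      have "edge M i (Suc (Suc i)) = diag M (Suc i) \<diamondop>
          bd (verts M (Suc i)) (entry M (Suc i) (Suc (Suc i))) \<diamondop> diag M (Suc (Suc i))"
        using seg_single[OF M, of i "Suc i"] edge_diag[OF M, of "Suc i"] i by (simp add: edge_less[of i])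
      then show ?thesis using 2 i by (auto simp: d_def coface_def)
    qed (use i edge_diag[OF M] in \<open>auto simp: d_def coface_def\<close>)
  qed
  have u: "u (Suc i) (Suc k) \<in> carrier (A (?x (Suc i))) \<and>
      ?a i (Suc i) (Suc k) = ?a i (Suc i) k \<otimes>\<^bsub>A (?x (Suc i))\<^esub> u (Suc i) (Suc k)"
    if ik: "i < k" "k < n" for i k
  proof -
    consider "j < Suc i" | "j = Suc n" | (below) "Suc i < j" "j \<le> n" | (at) "Suc i = j" "j \<le> n"
      using j by linarith
    then show ?thesis
    proof cases
      case below
      consider "Suc k < j" | "Suc k = j" | "j < Suc k" by linarith
      then show ?thesis
      proof cases
        case 2
        have e: "entry M (Suc i) (Suc k) \<in> carrier (A (verts M (Suc i)))"
          "entry M (Suc i) (Suc (Suc k)) \<in> carrier (A (verts M (Suc i)))"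
          using en ik by auto
        have s: "seg M (Suc i) (Suc i) k \<in> carrier (A (verts M (Suc i)))"
          using seg_closed[OF M, of i "Suc i" k] ik by simp
        have o: "verts M (Suc i) \<in> Obj C" using v ik by simp
        have "seg M (Suc i) (Suc i) (Suc (Suc k)) = seg M (Suc i) (Suc i) k \<otimes>\<^bsub>A (verts M (Suc i))\<^esub>
            (entry M (Suc i) (Suc k) \<otimes>\<^bsub>A (verts M (Suc i))\<^esub> entry M (Suc i) (Suc (Suc k)))"
          using seg_Suc[of i k] seg_Suc[of i "Suc k"] ik mult_assoc[OF o s e] by simp
        then show ?thesis
          using below 2 ik mult_closed[OF o e] tri_seg[OF M] by (auto simp: u_def coface_def)
      qed (use below ik en seg_Suc tri_seg[OF M] in \<open>auto simp: u_def coface_def\<close>)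
    next
      case at
      \<comment> \<open>The new vertices \<open>i, i + 1\<close> are \<open>i, i + 2\<close> in \<open>M\<close>, so the recursion of \<open>tri\<close> has two factors.\<close>
      let ?E = "diag M (Suc (Suc i))" and ?P = "seg M (Suc i) (Suc (Suc i)) (Suc k)"
      let ?T = "seg M (Suc (Suc i)) (Suc (Suc i)) (Suc k)"
      let ?e1 = "entry M (Suc i) (Suc (Suc k))" and ?e2 = "entry M (Suc (Suc i)) (Suc (Suc k))"
      let ?y = "verts M (Suc (Suc i))"
      have o: "?y \<in> Obj C" using v ik by simp
      have E: "?E \<in> hom_set C ?y (verts M (Suc i))" using dg ik by simp
      have P: "?P \<in> carrier (A (verts M (Suc i)))" and T: "?T \<in> carrier (A ?y)"
        using seg_closed[OF M] ik by auto
      have e1: "?e1 \<in> carrier (A (verts M (Suc i)))" and e2: "?e2 \<in> carrier (A ?y)"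
        using en ik by auto
      note EB = comp_in[OF E bd_in[OF o T]]
      have t: "tri M i (Suc (Suc i)) l = pull ?E (seg M (Suc i) (Suc (Suc i)) l)
          \<otimes>\<^bsub>A ?y\<^esub> seg M (Suc (Suc i)) (Suc (Suc i)) l" if "Suc i < l" "l \<le> Suc n" for l
        using tri_seg[OF M, of "Suc i" l] edge_diag[OF M, of "Suc i"] that by (simp add: tri_less[of i])
      have "tri M i (Suc (Suc i)) (Suc (Suc k)) = pull ?E (?P \<otimes>\<^bsub>A (verts M (Suc i))\<^esub> ?e1) \<otimes>\<^bsub>A ?y\<^esub> (?T \<otimes>\<^bsub>A ?y\<^esub> ?e2)"
        using t[of "Suc (Suc k)"] ik seg_Suc[of "Suc i" "Suc k"]
          seg_mult[OF M, of i "Suc (Suc i)" "Suc k" "Suc (Suc k)"] seg_single[OF M, of i "Suc k"] by simp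
      also have "\<dots> = pull ?E ?P \<otimes>\<^bsub>A ?y\<^esub> ((pull ?E ?e1 \<otimes>\<^bsub>A ?y\<^esub> ?T) \<otimes>\<^bsub>A ?y\<^esub> ?e2)"
        using o T e2 pull_closed[OF E P] pull_closed[OF E e1] pull_mult[OF E P e1]
        by (simp add: mult_assoc mult_closed)
      also have "\<dots> = (pull ?E ?P \<otimes>\<^bsub>A ?y\<^esub> ?T) \<otimes>\<^bsub>A ?y\<^esub> (pull (?E \<diamondop> bd ?y ?T) ?e1 \<otimes>\<^bsub>A ?y\<^esub> ?e2)"
        using o T e2 pull_closed[OF E P] pull_closed[OF EB e1]
        by (simp add: peiffer_pull[OF E e1 T] mult_assoc mult_closed)
      also have "pull ?E ?P \<otimes>\<^bsub>A ?y\<^esub> ?T = tri M i (Suc (Suc i)) (Suc k)"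
        using t[of "Suc k"] ik by simp
      finally show ?thesis
        using at ik mult_closed[OF o pull_closed[OF EB e1] e2] by (auto simp: u_def coface_def)
    qed (use ik en seg_Suc tri_seg[OF M] in \<open>auto simp: u_def coface_def\<close>)
  qed
  note r = realize_coherent[OF c F d u[THEN conjunct1] u[THEN conjunct2] canc]
  show "?F \<in> nerve_simplices C A n"
    and "i \<le> n \<Longrightarrow> verts ?F i = ?x i"
    and "i \<le> k \<Longrightarrow> k \<le> n \<Longrightarrow> edge ?F i k = ?f i k"
    and "i \<le> k \<Longrightarrow> k \<le> l \<Longrightarrow> l \<le> n \<Longrightarrow> tri ?F i k l = ?a i k l"
    using r by blast+
qed

text \<open>
  The identity and the units that a degeneracy inserts are the edge and the triangles in which the
  vertex \<open>j\<close> of \<open>M\<close> is repeated.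
\<close>

lemma
  assumes M: "M \<in> nerve_simplices C A n" and j: "j \<le> n"
  shows nerve_degen_in: "nerve_degen C A n j M \<in> nerve_simplices C A (Suc n)"
    and verts_degen: "i \<le> Suc n \<Longrightarrow> verts (nerve_degen C A n j M) i = verts M (codegen j i)"
    and edge_degen: "i \<le> k \<Longrightarrow> k \<le> Suc n \<Longrightarrow>
      edge (nerve_degen C A n j M) i k = edge M (codegen j i) (codegen j k)"
    and tri_degen: "i \<le> k \<Longrightarrow> k \<le> l \<Longrightarrow> l \<le> Suc n \<Longrightarrow>
      tri (nerve_degen C A n j M) i k l = tri M (codegen j i) (codegen j k) (codegen j l)"
proof -
  let ?D = "nerve_degen C A n j M"
  let ?x = "\<lambda>i. verts M (codegen j i)" and ?f = "\<lambda>i k. edge M (codegen j i) (codegen j k)"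
    and ?a = "\<lambda>i k l. tri M (codegen j i) (codegen j k) (codegen j l)"
  note v = verts_in[OF M] and en = entry_in[OF M]
  note c = coherent_reindex[OF coherent_nerve[OF M] codegen_mono_on(1) codegen_mono_on(2)[OF j]]
  have canc: "left_cancellative (A (?x i))" if "i \<le> Suc n" for i
    using that v codegen_le j left_cancel by simp
  define d where "d = (\<lambda>i. if i \<le> j then diag M i else if i = Suc j then ident C (verts M j) else diag M (i - 1))"
  define u where "u = (\<lambda>i k. if i \<le> j then
          (if k \<le> j then entry M i k else if k = Suc j then \<one>\<^bsub>A (verts M i)\<^esub> else entry M i (k - 1))
        else if i = Suc j then \<one>\<^bsub>A (verts M j)\<^esub>
        else entry M (i - 1) (k - 1))"
  have D: "?D = (if Suc n = 0 then Vertex (?x 0) else mk_matrix (Suc n) d u)"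
    by (simp add: nerve_degen_eq[OF M j] d_def u_def)
  have d: "d (Suc i) = ?f i (Suc i)" if i: "i < Suc n" for i
  proof -
    consider "i < j" | "i = j" | i' where "i = Suc i'" "j \<le> i'"
      by (metis less_Suc_eq_le linorder_neqE_nat not0_implies_Suc not_less_zero)
    then show ?thesis
      using i j edge_diag[OF M] by cases (auto simp: d_def codegen_def)
  qed
  have seg_Suc: "seg M (Suc i) (Suc i) (Suc k) = seg M (Suc i) (Suc i) k \<otimes>\<^bsub>A (verts M (Suc i))\<^esub> entry M (Suc i) (Suc k)"
    if "i < k" "k < n" for i k
    using seg_mult[OF M, of i "Suc i" k "Suc k"] seg_single[OF M, of i k] that by simp
  have u: "u (Suc i) (Suc k) \<in> carrier (A (?x (Suc i))) \<and>
      ?a i (Suc i) (Suc k) = ?a i (Suc i) k \<otimes>\<^bsub>A (?x (Suc i))\<^esub> u (Suc i) (Suc k)"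
    if ik: "i < k" "k < Suc n" for i k
  proof -
    consider (above) i' k' where "i = Suc i'" "j \<le> i'" "k = Suc k'" | (at) "i = j"
      | (lo) "k < j" "i < j" | (eq) "k = j" "i < j" | (hi) k' where "k = Suc k'" "j \<le> k'" "i < j"
    proof -
      obtain k' where k: "k = Suc k'" using ik by (cases k) auto
      show ?thesis
      proof (cases "j < i")
        case True
        then obtain i' where "i = Suc i'" by (cases i) auto
        then show ?thesis using above k True by simp
      next
        case False
        then have "i = j \<or> i < j" "k < j \<or> k = j \<or> j \<le> k'" using k by auto
        then show ?thesis using at lo eq hi k by blast
      qed
    qed
    then show ?thesis
    proof cases
      case above
      then show ?thesis using ik en seg_Suc tri_seg[OF M] by (auto simp: u_def codegen_def)
    next
      case at
      then show ?thesis using ik j v one_closed mult_one by (auto simp: u_def codegen_def)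
    next
      case lo
      then show ?thesis using j ik en seg_Suc tri_seg[OF M] by (auto simp: u_def codegen_def)
    next
      case eq
      then show ?thesis using j ik v one_closed mult_one(2)[OF v tri_in[OF M]] by (auto simp: u_def codegen_def)
    next
      case hi
      then show ?thesis using j ik en seg_Suc tri_seg[OF M] by (auto simp: u_def codegen_def)
    qed
  qed
  note r = realize_coherent[OF c D d u[THEN conjunct1] u[THEN conjunct2] canc]
  show "?D \<in> nerve_simplices C A (Suc n)"
    and "i \<le> Suc n \<Longrightarrow> verts ?D i = ?x i"
    and "i \<le> k \<Longrightarrow> k \<le> Suc n \<Longrightarrow> edge ?D i k = ?f i k"
    and "i \<le> k \<Longrightarrow> k \<le> l \<Longrightarrow> l \<le> Suc n \<Longrightarrow> tri ?D i k l = ?a i k l"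
    using r by blast+
qed

section \<open>Coskeletality of the nerve\<close>

definition label :: "('o, 'm, 'a) nerve_simplex \<Rightarrow> nat list \<Rightarrow> 'o \<times> 'm \<times> 'a"
  where "label M \<rho> = (verts M (\<rho> ! 0), edge M (\<rho> ! 0) (\<rho> ! 1), tri M (\<rho> ! 0) (\<rho> ! 1) (\<rho> ! 2))"

lemma label_Cons [simp]: "label M [i, j, k] = (verts M i, edge M i j, tri M i j k)"
  by (simp add: label_def numeral_2_eq_2)

lemma std_simplex_2: "\<rho> \<in> simplices (std_simplex n) 2 \<longleftrightarrow>
    (\<exists>i j k. \<rho> = [i, j, k] \<and> i \<le> j \<and> j \<le> k \<and> k \<le> n)"
  by (auto simp: std_simplex_simps numeral_2_eq_2 length_Suc_conv)

text \<open>
  The decorations of the triangles on \<open>i, i + 1, k\<close> are the initial products of row \<open>i + 1\<close>, from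
  which the entries of the row are recovered by left cancellation.
\<close>

lemma label_inj:
  assumes M: "M \<in> nerve_simplices C A n" and M': "M' \<in> nerve_simplices C A n"
    and eq: "\<And>\<rho>. \<rho> \<in> simplices (std_simplex n) 2 \<Longrightarrow> label M \<rho> = label M' \<rho>"
  shows "M = M'"
proof -
  have e: "verts M i = verts M' i" "edge M i j = edge M' i j" "tri M i j k = tri M' i j k"
    if "i \<le> j" "j \<le> k" "k \<le> n" for i j k
    using eq[of "[i, j, k]"] that by (auto simp: std_simplex_2)
  show ?thesis
  proof (rule nerve_simplex_eqI[OF M M'])
    show "verts M 0 = verts M' 0" using e(1)[of 0 0 0] by simp
    show "diag M (Suc i) = diag M' (Suc i)" if "i < n" for i
      using e(2)[of i "Suc i" "Suc i"] that edge_diag[OF M] edge_diag[OF M'] by simp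
    fix i k assume ik: "i < k" "k < n"
    have v: "verts M (Suc i) = verts M' (Suc i)" using e(1)[of "Suc i" "Suc i" "Suc i"] ik by simp
    have s: "seg M (Suc i) (Suc i) l = seg M' (Suc i) (Suc i) l" if "i < l" "l \<le> n" for l
      using e(3)[of i "Suc i" l] that tri_seg[OF M] tri_seg[OF M'] by simp
    have "seg M (Suc i) (Suc i) k \<otimes>\<^bsub>A (verts M (Suc i))\<^esub> entry M (Suc i) (Suc k)
        = seg M (Suc i) (Suc i) k \<otimes>\<^bsub>A (verts M (Suc i))\<^esub> entry M' (Suc i) (Suc k)"
      using s[of k] s[of "Suc k"] ik v seg_mult[OF M, of i "Suc i" k "Suc k"] seg_mult[OF M', of i "Suc i" k "Suc k"]
        seg_single[OF M, of i k] seg_single[OF M', of i k] by simp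
    then show "entry M (Suc i) (Suc k) = entry M' (Suc i) (Suc k)"
      using left_cancel[OF verts_in[OF M, of "Suc i"]] seg_closed[OF M, of i "Suc i" k]
        entry_in[OF M, of i "Suc k"] entry_in[OF M', of i "Suc k"] v ik
      unfolding left_cancellative_def by simp
  qed
qed

lemma face_labelling_nerve: "face_labelling (nerve C A pull bd) 2 (\<lambda>_. label)"
proof
  fix j n x \<rho>
  show "face (nerve C A pull bd) (Suc n) j x \<in> simplices (nerve C A pull bd) n"
    if "j \<le> Suc n" "x \<in> simplices (nerve C A pull bd) (Suc n)"
    using that nerve_face_in by (simp add: nerve_def)
  show "degen (nerve C A pull bd) n j x \<in> simplices (nerve C A pull bd) (Suc n)"
    if "j \<le> n" "x \<in> simplices (nerve C A pull bd) n"
    using that nerve_degen_in by (simp add: nerve_def)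
  show "label (face (nerve C A pull bd) (Suc n) j x) \<rho> = label x (map (coface j) \<rho>)"
    if "j \<le> Suc n" "x \<in> simplices (nerve C A pull bd) (Suc n)" "\<rho> \<in> simplices (std_simplex n) 2"
    using that by (auto simp: nerve_def std_simplex_2 verts_face edge_face tri_face)
  show "label (degen (nerve C A pull bd) n j x) \<rho> = label x (map (codegen j) \<rho>)"
    if "j \<le> n" "x \<in> simplices (nerve C A pull bd) n" "\<rho> \<in> simplices (std_simplex (Suc n)) 2"
    using that by (auto simp: nerve_def std_simplex_2 verts_degen edge_degen tri_degen)
qed (rule label_inj; simp add: nerve_def)

text \<open>
  Labels that come from 3-simplices on every quadruple of vertices are coherent, and the entry
  in row \<open>i + 1\<close> and column \<open>k + 1\<close> of the filler is a \<open>b\<close> belonging to \<open>i, i + 1, k, k + 1\<close>.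
\<close>

lemma nerve_local_fillers:
  assumes loc: "\<And>\<theta>. \<theta> \<in> simplices (std_simplex n) 3 \<Longrightarrow> \<exists>M\<in>nerve_simplices C A 3.
      \<forall>\<rho>\<in>simplices (std_simplex 3) 2. label M \<rho> = F (map ((!) \<theta>) \<rho>)"
  shows "\<exists>M\<in>nerve_simplices C A n. \<forall>\<rho>\<in>simplices (std_simplex n) 2. label M \<rho> = F \<rho>"
proof -
  define x where "x i = fst (F [i, i, i])" for i
  define f where "f i j = fst (snd (F [i, j, j]))" for i j
  define a where "a i j k = snd (snd (F [i, j, k]))" for i j k
  have loc': "\<exists>M\<in>nerve_simplices C A 3. \<forall>p q r. p \<le> q \<and> q \<le> r \<and> r \<le> 3 \<longrightarrow>
      F [[i, j, k, l] ! p, [i, j, k, l] ! q, [i, j, k, l] ! r] = (verts M p, edge M p q, tri M p q r)"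
    if "i \<le> j" "j \<le> k" "k \<le> l" "l \<le> n" for i j k l
  proof -
    have "[i, j, k, l] \<in> simplices (std_simplex n) 3" using that by (auto simp: std_simplex_simps)
    from loc[OF this] obtain M where M: "M \<in> nerve_simplices C A 3"
      "\<And>\<rho>. \<rho> \<in> simplices (std_simplex 3) 2 \<Longrightarrow> label M \<rho> = F (map ((!) [i, j, k, l]) \<rho>)" by auto
    have "F [[i, j, k, l] ! p, [i, j, k, l] ! q, [i, j, k, l] ! r] = (verts M p, edge M p q, tri M p q r)"
      if "p \<le> q" "q \<le> r" "r \<le> 3" for p q r
      using M(2)[of "[p, q, r]"] that by (simp add: std_simplex_2)
    then show ?thesis using M(1) by blast
  qed
  have coh: "coherent 3 (\<lambda>p. x (h p)) (\<lambda>p q. f (h p) (h q)) (\<lambda>p q r. a (h p) (h q) (h r))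
      \<and> F [i, j, k] = (x i, f i j, a i j k)"
    if ijkl: "i \<le> j" "j \<le> k" "k \<le> l" "l \<le> n" and h: "h = (!) [i, j, k, l]" for i j k l h
  proof -
    obtain M where M: "M \<in> nerve_simplices C A 3" "\<And>p q r. p \<le> q \<Longrightarrow> q \<le> r \<Longrightarrow> r \<le> 3 \<Longrightarrow>
      F [h p, h q, h r] = (verts M p, edge M p q, tri M p q r)"
      using loc'[OF ijkl] unfolding h by blast
    have 1: "x (h p) = verts M p" if "p \<le> 3" for p using M(2)[of p p p] that by (simp add: x_def)
    have 2: "f (h p) (h q) = edge M p q" if "p \<le> q" "q \<le> 3" for p q using M(2)[of p q q] that by (simp add: f_def)
    have 3: "a (h p) (h q) (h r) = tri M p q r" if "p \<le> q" "q \<le> r" "r \<le> 3" for p q r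
      using M(2)[of p q r] that by (simp add: a_def)
    have "coherent 3 (\<lambda>p. x (h p)) (\<lambda>p q. f (h p) (h q)) (\<lambda>p q r. a (h p) (h q) (h r))"
      by (rule coherent_cong[OF coherent_nerve[OF M(1)] 1 2 3])
    moreover have "F [h 0, h 1, h 2] = (x (h 0), f (h 0) (h 1), a (h 0) (h 1) (h 2))"
      using M(2)[of 0 1 2] 1[of 0] 2[of 0 1] 3[of 0 1 2] by simp
    ultimately show ?thesis using h by (simp add: numeral_2_eq_2)
  qed
  have c: "coherent n x f a"
  proof (rule coherent_local)
    fix i j k l assume "i \<le> j" "j \<le> k" "k \<le> l" "l \<le> n"
    from coh[OF this refl]
    show "coherent 3 (\<lambda>p. x ([i, j, k, l] ! p)) (\<lambda>p q. f ([i, j, k, l] ! p) ([i, j, k, l] ! q))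
      (\<lambda>p q r. a ([i, j, k, l] ! p) ([i, j, k, l] ! q) ([i, j, k, l] ! r))" by simp
  qed
  have "\<exists>b. b \<in> carrier (A (x (Suc i))) \<and> a i (Suc i) (Suc k) = a i (Suc i) k \<otimes>\<^bsub>A (x (Suc i))\<^esub> b"
    if "i < k" "k < n" for i k
    using c that unfolding coherent_def by (metis Suc_leI le_SucI le_refl less_imp_le_nat)
  then obtain b where b: "\<And>i k. i < k \<Longrightarrow> k < n \<Longrightarrow> b i k \<in> carrier (A (x (Suc i)))"
    "\<And>i k. i < k \<Longrightarrow> k < n \<Longrightarrow> a i (Suc i) (Suc k) = a i (Suc i) k \<otimes>\<^bsub>A (x (Suc i))\<^esub> b i k"
    by metis
  define d where "d i = f (i - 1) i" for i
  define u where "u i k = b (i - 1) (k - 1)" for i k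
  define M where "M = (if n = 0 then Vertex (x 0) else mk_matrix n d u)"
  have d: "d (Suc i) = f i (Suc i)" for i by (simp add: d_def)
  have u: "u (Suc i) (Suc k) = b i k" for i k by (simp add: u_def)
  have x: "x i \<in> Obj C" if "i \<le> n" for i using c that by (simp add: coherent_def)
  note r = realize_coherent[OF c M_def d b[folded u] left_cancel[OF x]]
  show ?thesis
  proof (intro bexI[OF _ r(1)] ballI)
    fix \<rho> assume "\<rho> \<in> simplices (std_simplex n) 2"
    then obtain i j k where \<rho>: "\<rho> = [i, j, k]" "i \<le> j" "j \<le> k" "k \<le> n" by (auto simp: std_simplex_2)
    \<comment> \<open>The triangle \<open>i, j, k\<close> lies in the degenerate quadruple \<open>i, j, k, k\<close>.\<close>
    then show "label M \<rho> = F \<rho>"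
      using coh[of i j k k "(!) [i, j, k, k]"] r(2)[of i] r(3)[of i j] r(4)[of i j k] by simp
  qed
qed

theorem coskeletal_nerve: "coskeletal 3 (nerve C A pull bd)"
proof (rule face_labelling.coskeletal_if_local_fillers[OF face_labelling_nerve])
  have N: "simplices (nerve C A pull bd) = nerve_simplices C A" by (simp add: nerve_def)
  fix n F
  assume "\<And>\<theta>. \<theta> \<in> simplices (std_simplex n) 3 \<Longrightarrow> \<exists>y\<in>simplices (nerve C A pull bd) 3.
      \<forall>\<rho>\<in>simplices (std_simplex 3) 2. label y \<rho> = F (map ((!) \<theta>) \<rho>)"
  then show "\<exists>x\<in>simplices (nerve C A pull bd) n. \<forall>\<rho>\<in>simplices (std_simplex n) 2. label x \<rho> = F \<rho>"
    unfolding N by (rule nerve_local_fillers)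
qed simp

end

theorem theorem4p2:
  fixes C :: "('o, 'm) cat"
    and A :: "'o \<Rightarrow> 'a monoid"
    and pull :: "'m \<Rightarrow> 'a \<Rightarrow> 'a"
    and bd :: "'o \<Rightarrow> 'a \<Rightarrow> 'm"
  assumes "crossed_monoid C A pull bd"
    and "\<And>t. t \<in> Obj C \<Longrightarrow> left_cancellative (A t) \<and> right_cancellative (A t)"
    and "\<And>s t \<gamma>. \<gamma> \<in> hom_set C s t \<Longrightarrow> inj_on (pull \<gamma>) (carrier (A t))"
  shows "coskeletal 3 (nerve C A pull bd)"
proof -
  interpret left_cancellative_crossed_monoid C A pull bd
    using assms(1,2) by (simp add: left_cancellative_crossed_monoid_def left_cancellative_crossed_monoid_axioms_def)
  show ?thesis by (rule coskeletal_nerve)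
qed

end
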